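(* Let $\Omega\subset\mathbb{C}^n$ be a bounded domain and let $1<q<2<p<\infty$ with $\frac1p+\frac1q=1$. Assume that the maps $\Phi_p:\mathcal{A}^q(\Omega)\to\mathcal{A}^p(\Omega)'$ and $\Phi_q:\mathcal{A}^p(\Omega)\to\mathcal{A}^q(\Omega)'$ are surjective. Let $\theta\in(0,1)$ and let $p_\theta$ be defined by $\frac{1}{p_\theta}=\frac{1-\theta}{p}+\frac{\theta}{q}$. Then $$[\mathcal{A}^p(\Omega),\mathcal{A}^q(\Omega)]_\theta=\mathcal{A}^{p_\theta}(\Omega)$$ with equivalent norms.
   Context: For a bounded domain $\Omega\subset\mathbb{C}^n$ and $1\le r<\infty$, $\mathcal{A}^r(\Omega)=\{f\in L^r(\Omega): f \text{ is holomorphic in }\Omega\}$ (Lebesgue measure), with the $L^r$ norm. A prime denotes the Banach space dual. Write $\langle f,g\rangle=\int_\Omega f\overline g\,dV$. For conjugate exponents $r,s\in(1,\infty)$, $\frac1r+\frac1s=1$, the conjugate-linear map $\Phi_r:\mathcal{A}^s(\Omega)\to\mathcal{A}^r(\Omega)'$ is defined by $\Phi_r(g)(f)=\langle f,g\rangle$ for $g\in\mathcal{A}^s(\Omega)$, $f\in\mathcal{A}^r(\Omega)$. Complex interpolation: a pair $(X_0,X_1)$ of Banach spaces is a Banach couple if both are continuously included in a common Hausdorff topological vector space; $X_0+X_1$ carries the usual sum norm. (Here $\mathcal{A}^p(\Omega)\subset\mathcal{A}^q(\Omega)$ continuously since $\Omega$ is bounded and $q<p$.) Let $S=\{x+iy:0<x<1\}$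 and $\overline S=\{x+iy:0\le x\le 1\}$. Let $\mathcal{F}(X_0,X_1)$ be the space of bounded continuous functions $f:\overline S\to X_0+X_1$ that are analytic in $S$, satisfy $f(it)\in X_0$ and $f(1+it)\in X_1$ for all $t\in\mathbb{R}$, and have finite norm $$\|f\|_{\mathcal{F}(X_0,X_1)}=\max\Big\{\sup_{t\in\mathbb{R}}\|f(it)\|_{X_0},\ \sup_{t\in\mathbb{R}}\|f(1+it)\|_{X_1}\Big\}.$$ For $\theta\in(0,1)$, $[X_0,X_1]_\theta=\{f(\theta): f\in\mathcal{F}(X_0,X_1)\}\subset X_0+X_1$, with norm $\|x\|_{\theta}=\inf\{\|f\|_{\mathcal{F}(X_0,X_1)}: f\in\mathcal{F}(X_0,X_1),\ f(\theta)=x\}$. *)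

theory Defs
  imports "HOL-Analysis.Analysis" "HOL-Library.FuncSet"
begin

section \<open>Normed spaces of complex-valued functions\<close>

text \<open>
  A normed space is represented by a carrier inside the space of all functions
  \<open>'x \<Rightarrow> complex\<close> (with pointwise operations), together with a norm that is only meaningful on
  the carrier. With pointwise convergence, \<open>'x \<Rightarrow> complex\<close> is a Hausdorff topological vector
  space; it serves as the common ambient space of the two members of a Banach couple.
\<close>

record 'x normed_fun_space =
  fcarrier :: "('x \<Rightarrow> complex) set"
  fnorm :: "('x \<Rightarrow> complex) \<Rightarrow> real"

text \<open>Elements of the dual are extensional, so that equal functionals are equal as HOL functions.\<close>

definition dual_space :: "'x normed_fun_space \<Rightarrow> (('x \<Rightarrow> complex) \<Rightarrow> complex) set" where
  "dual_space X = {L \<in> extensional (fcarrier X).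
     (\<forall>f\<in>fcarrier X. \<forall>g\<in>fcarrier X. L (\<lambda>x. f x + g x) = L f + L g) \<and>
     (\<forall>c. \<forall>f\<in>fcarrier X. L (\<lambda>x. c * f x) = c * L f) \<and>
     (\<exists>B. \<forall>f\<in>fcarrier X. norm (L f) \<le> B * fnorm X f)}"

definition equal_with_equivalent_norms ::
  "'x normed_fun_space \<Rightarrow> 'x normed_fun_space \<Rightarrow> bool" where
  "equal_with_equivalent_norms X Y \<longleftrightarrow> fcarrier X = fcarrier Y \<and>
     (\<exists>c>0. \<exists>C>0. \<forall>f\<in>fcarrier X. c * fnorm Y f \<le> fnorm X f \<and> fnorm X f \<le> C * fnorm Y f)"

section \<open>Complex interpolation\<close>

definition sum_space ::
  "'x normed_fun_space \<Rightarrow> 'x normed_fun_space \<Rightarrow> 'x normed_fun_space" where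
  "sum_space X0 X1 =
     \<lparr>fcarrier = {\<lambda>x. a x + b x | a b. a \<in> fcarrier X0 \<and> b \<in> fcarrier X1},
      fnorm = (\<lambda>f. Inf {fnorm X0 a + fnorm X1 b | a b.
                 a \<in> fcarrier X0 \<and> b \<in> fcarrier X1 \<and> f = (\<lambda>x. a x + b x)})\<rparr>"

definition open_strip :: "complex set" where
  "open_strip = {z. 0 < Re z \<and> Re z < 1}"

definition closed_strip :: "complex set" where
  "closed_strip = {z. 0 \<le> Re z \<and> Re z \<le> 1}"

text \<open>Continuity and (complex) differentiability of space-valued maps are in the norm.\<close>

definition norm_continuous_on ::
  "complex set \<Rightarrow> 'x normed_fun_space \<Rightarrow> (complex \<Rightarrow> 'x \<Rightarrow> complex) \<Rightarrow> bool" where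
  "norm_continuous_on T X F \<longleftrightarrow>
     (\<forall>z\<in>T. ((\<lambda>w. fnorm X (\<lambda>x. F w x - F z x)) \<longlongrightarrow> 0) (at z within T))"

definition norm_analytic_on ::
  "complex set \<Rightarrow> 'x normed_fun_space \<Rightarrow> (complex \<Rightarrow> 'x \<Rightarrow> complex) \<Rightarrow> bool" where
  "norm_analytic_on T X F \<longleftrightarrow>
     (\<forall>z\<in>T. \<exists>D\<in>fcarrier X.
        ((\<lambda>w. fnorm X (\<lambda>x. (F w x - F z x) / (w - z) - D x)) \<longlongrightarrow> 0) (at z within T))"

text \<open>
  The values of an element of \<open>\<F>(X0, X1)\<close> outside the closed strip are irrelevant and
  left arbitrary. The two \<open>bdd_above\<close> conditions express finiteness of its norm.
\<close>

definition calderon_functions ::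
  "'x normed_fun_space \<Rightarrow> 'x normed_fun_space \<Rightarrow> (complex \<Rightarrow> 'x \<Rightarrow> complex) set" where
  "calderon_functions X0 X1 = {F.
     (\<forall>z\<in>closed_strip. F z \<in> fcarrier (sum_space X0 X1)) \<and>
     (\<exists>B. \<forall>z\<in>closed_strip. fnorm (sum_space X0 X1) (F z) \<le> B) \<and>
     norm_continuous_on closed_strip (sum_space X0 X1) F \<and>
     norm_analytic_on open_strip (sum_space X0 X1) F \<and>
     (\<forall>t. F (Complex 0 t) \<in> fcarrier X0) \<and>
     (\<forall>t. F (Complex 1 t) \<in> fcarrier X1) \<and>
     bdd_above (range (\<lambda>t. fnorm X0 (F (Complex 0 t)))) \<and>
     bdd_above (range (\<lambda>t. fnorm X1 (F (Complex 1 t))))}"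

definition calderon_norm ::
  "'x normed_fun_space \<Rightarrow> 'x normed_fun_space \<Rightarrow> (complex \<Rightarrow> 'x \<Rightarrow> complex) \<Rightarrow> real" where
  "calderon_norm X0 X1 F =
     max (SUP t. fnorm X0 (F (Complex 0 t))) (SUP t. fnorm X1 (F (Complex 1 t)))"

definition complex_interpolation ::
  "'x normed_fun_space \<Rightarrow> 'x normed_fun_space \<Rightarrow> real \<Rightarrow> 'x normed_fun_space" where
  "complex_interpolation X0 X1 \<theta> =
     \<lparr>fcarrier = {F (complex_of_real \<theta>) | F. F \<in> calderon_functions X0 X1},
      fnorm = (\<lambda>f. Inf {calderon_norm X0 X1 F | F.
                 F \<in> calderon_functions X0 X1 \<and> F (complex_of_real \<theta>) = f})\<rparr>"

section \<open>Bergman spaces\<close>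

definition bounded_domain :: "(complex ^ 'n) set \<Rightarrow> bool" where
  "bounded_domain \<Omega> \<longleftrightarrow> open \<Omega> \<and> connected \<Omega> \<and> \<Omega> \<noteq> {} \<and> bounded \<Omega>"

text \<open>Holomorphy in several variables: the Frechet derivative exists and is complex-linear.\<close>

definition holomorphic_in :: "(complex ^ 'n) set \<Rightarrow> (complex ^ 'n \<Rightarrow> complex) \<Rightarrow> bool" where
  "holomorphic_in \<Omega> f \<longleftrightarrow>
     (\<forall>z\<in>\<Omega>. \<exists>D. (f has_derivative D) (at z) \<and> (\<forall>c v. D (c *s v) = c * D v))"

definition in_Lr :: "(complex ^ 'n) set \<Rightarrow> real \<Rightarrow> (complex ^ 'n \<Rightarrow> complex) \<Rightarrow> bool" where
  "in_Lr \<Omega> r f \<longleftrightarrow> set_borel_measurable lborel \<Omega> f \<and>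
     set_integrable lborel \<Omega> (\<lambda>z. norm (f z) powr r)"

definition Lr_norm :: "(complex ^ 'n) set \<Rightarrow> real \<Rightarrow> (complex ^ 'n \<Rightarrow> complex) \<Rightarrow> real" where
  "Lr_norm \<Omega> r f = (LINT z:\<Omega>|lborel. norm (f z) powr r) powr (1 / r)"

text \<open>
  A function on \<open>\<Omega>\<close> is represented by its extension by zero, so that distinct elements of the
  carrier differ as functions on \<open>\<Omega>\<close> and the carrier is closed under pointwise operations.
\<close>

definition bergman_space ::
  "(complex ^ 'n) set \<Rightarrow> real \<Rightarrow> (complex ^ 'n) normed_fun_space" where
  "bergman_space \<Omega> r =
     \<lparr>fcarrier = {f. in_Lr \<Omega> r f \<and> holomorphic_in \<Omega> f \<and> (\<forall>z. z \<notin> \<Omega> \<longrightarrow> f z = 0)},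
      fnorm = Lr_norm \<Omega> r\<rparr>"

definition pairing ::
  "(complex ^ 'n) set \<Rightarrow> (complex ^ 'n \<Rightarrow> complex) \<Rightarrow> (complex ^ 'n \<Rightarrow> complex) \<Rightarrow> complex" where
  "pairing \<Omega> f g = (LINT z:\<Omega>|lborel. f z * cnj (g z))"

definition Phi ::
  "(complex ^ 'n) set \<Rightarrow> real \<Rightarrow> (complex ^ 'n \<Rightarrow> complex)
     \<Rightarrow> (complex ^ 'n \<Rightarrow> complex) \<Rightarrow> complex" where
  "Phi \<Omega> r g = restrict (\<lambda>f. pairing \<Omega> f g) (fcarrier (bergman_space \<Omega> r))"

text \<open>
  Surjectivity of \<open>Phi \<Omega> r\<close> from the Bergman space of exponent \<open>s\<close> onto the dual of the one of
  exponent \<open>r\<close>; that it maps into the dual is Hoelder's inequality for conjugate \<open>r\<close> and \<open>s\<close>.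
\<close>

definition Phi_surjective :: "(complex ^ 'n) set \<Rightarrow> real \<Rightarrow> real \<Rightarrow> bool" where
  "Phi_surjective \<Omega> r s \<longleftrightarrow>
     (\<forall>L\<in>dual_space (bergman_space \<Omega> r). \<exists>g\<in>fcarrier (bergman_space \<Omega> s). Phi \<Omega> r g = L)"

end

theory Submission
  imports Defs "HOL-Complex_Analysis.Complex_Analysis"
begin

text \<open>
  The two surjectivity hypotheses make the spaces \<open>A\<^sup>p\<close> and \<open>A\<^sup>q\<close> retracts of the Lebesgue spaces
  \<open>L\<^sup>p\<close> and \<open>L\<^sup>q\<close> under one and the same operator, and then the classical argument for the
  interpolation of Lebesgue spaces applies.

  The operator is the Bergman projection. Evaluation at a point \<open>z\<close> is a bounded functional on \<open>A\<^sup>q\<close>,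
  by the mean value property (\<open>bergman_point_evaluation\<close>), so surjectivity of \<open>\<Phi>\<^sub>q\<close> represents it by a
  kernel \<open>\<kappa> z\<close> in \<open>A\<^sup>p\<close>. Put \<open>T h z = \<langle>h, \<kappa> z\<rangle>\<close>. Then \<open>T f = f\<close> for \<open>f\<close> in \<open>A\<^sup>q\<close>, and for
  \<open>h\<close> in \<open>L\<^sup>s\<close> (\<open>s = p\<close> or \<open>s = q\<close>, \<open>r\<close> the conjugate exponent) the function \<open>T h\<close> is the element of
  \<open>A\<^sup>s\<close> that represents the functional \<open>\<langle>\<cdot>, h\<rangle>\<close> on \<open>A\<^sup>r\<close>; it exists by surjectivity. Boundedness of
  \<open>T\<close> on \<open>L\<^sup>s\<close> is therefore boundedness of the inverse of \<open>\<Phi>\<^sub>r\<close> (\<open>Phi_inverse_bounded\<close>). It follows from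
  a category argument on the dual of \<open>A\<^sup>r\<close>: convergence there forces pointwise convergence of the
  representing functions, by means of the kernels, so by Fatou's lemma the \<open>L\<^sup>s\<close> norm of the
  representing function is lower semicontinuous, and a lower semicontinuous seminorm that is finite on
  a complete space is bounded.

  For \<open>f\<close> in \<open>A\<^sup>t\<close>, \<open>t = p\<^sub>\<theta>\<close>, of norm at most \<open>c\<close>, the function
  \<open>F z = T (c \<cdot> sgn f \<cdot> (\<bar>f\<bar> / c) ^ (t ((1 - z) / p + z / q)))\<close> lies in the Calderon space, takes the
  value \<open>T f = f\<close> at \<open>\<theta>\<close>, and its norm is at most a constant multiple of \<open>c\<close>
  (\<open>bergman_extends_to_calderon\<close>). Conversely, let \<open>f = F \<theta>\<close> and let \<open>G z\<close> be the analytic family with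
  exponents \<open>(1 - z) / q + z / p\<close> built from a truncation of \<open>f\<close>. The three lines theorem for the
  function \<open>z \<mapsto> \<integral> F z \<cdot> G z\<close> bounds the \<open>L\<^sup>t\<close> norm of the truncation of \<open>f\<close> by the norm of \<open>F\<close>, and
  Fatou's lemma removes the truncation (\<open>interpolated_in_L_space\<close>). This direction gives the constant 1.
\<close>

section \<open>Lebesgue spaces of complex-valued functions\<close>

definition L_space :: "'a measure \<Rightarrow> real \<Rightarrow> ('a \<Rightarrow> complex) set" where
  "L_space M r = {f \<in> borel_measurable M. integrable M (\<lambda>x. norm (f x) powr r)}"

definition L_norm :: "'a measure \<Rightarrow> real \<Rightarrow> ('a \<Rightarrow> complex) \<Rightarrow> real" where
  "L_norm M r f = (\<integral>x. norm (f x) powr r \<partial>M) powr (1 / r)"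

lemma L_spaceI:
  "\<lbrakk>f \<in> borel_measurable M; integrable M (\<lambda>x. norm (f x) powr r)\<rbrakk> \<Longrightarrow> f \<in> L_space M r"
  by (simp add: L_space_def)

lemma L_space_measurable [measurable_dest]: "f \<in> L_space M r \<Longrightarrow> f \<in> borel_measurable M"
  by (simp add: L_space_def)

lemma L_space_integrable: "f \<in> L_space M r \<Longrightarrow> integrable M (\<lambda>x. norm (f x) powr r)"
  by (simp add: L_space_def)

lemma L_norm_nonneg [simp]: "0 \<le> L_norm M r f"
  by (simp add: L_norm_def)

lemma L_norm_powr:
  assumes "0 < r"
  shows "L_norm M r f powr r = (\<integral>x. norm (f x) powr r \<partial>M)"
  using assms by (simp add: L_norm_def powr_powr)

lemma L_norm_le_iff:
  assumes "0 < r" "0 \<le> K"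
  shows "L_norm M r f \<le> K \<longleftrightarrow> (\<integral>x. norm (f x) powr r \<partial>M) \<le> K powr r"
  by (metis assms L_norm_nonneg L_norm_powr powr_mono2 linorder_not_le powr_less_mono2 less_imp_le)

lemma L_space_mono:
  assumes "f \<in> borel_measurable M" "integrable M w" "\<And>x. x \<in> space M \<Longrightarrow> norm (f x) powr r \<le> w x"
  shows "f \<in> L_space M r"
  by (rule L_spaceI[OF assms(1)], rule Bochner_Integration.integrable_bound[OF assms(2)])
     (use assms in \<open>auto intro!: AE_I2 intro: order_trans[OF _ abs_ge_self]\<close>)

lemma norm_add_powr_le:
  fixes a b :: complex
  assumes "0 < r"
  shows "norm (a + b) powr r \<le> 2 powr r * (norm a powr r + norm b powr r)"
proof -
  have "norm (a + b) powr r \<le> (2 * max (norm a) (norm b)) powr r"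
    using norm_triangle_ineq[of a b] assms by (intro powr_mono2) auto
  also have "\<dots> = 2 powr r * max (norm a) (norm b) powr r"
    by (simp add: powr_mult)
  also have "\<dots> \<le> 2 powr r * (norm a powr r + norm b powr r)"
    by (intro mult_left_mono) (auto simp: max_def)
  finally show ?thesis .
qed

lemma L_space_add:
  assumes "0 < r" "f \<in> L_space M r" "g \<in> L_space M r"
  shows "(\<lambda>x. f x + g x) \<in> L_space M r"
proof (rule L_space_mono)
  show "(\<lambda>x. f x + g x) \<in> borel_measurable M"
    using assms by (auto simp: L_space_def)
  show "integrable M (\<lambda>x. 2 powr r * (norm (f x) powr r + norm (g x) powr r))"
    using assms by (auto simp: L_space_def)
qed (use assms norm_add_powr_le in auto)

lemma L_space_cmult:
  assumes "f \<in> L_space M r"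
  shows "(\<lambda>x. c * f x) \<in> L_space M r"
  using assms by (auto simp: L_space_def norm_mult powr_mult)

lemma L_space_diff:
  assumes "0 < r" "f \<in> L_space M r" "g \<in> L_space M r"
  shows "(\<lambda>x. f x - g x) \<in> L_space M r"
  using L_space_add[OF assms(1,2) L_space_cmult[OF assms(3), of "-1"]] by simp

lemma L_space_cnj: "f \<in> L_space M r \<Longrightarrow> (\<lambda>x. cnj (f x)) \<in> L_space M r"
  using borel_measurable_continuous_onI[OF continuous_on_cnj[OF continuous_on_id]]
  by (auto simp: L_space_def intro: measurable_compose[of f M borel cnj])

lemma L_norm_cnj [simp]: "L_norm M r (\<lambda>x. cnj (f x)) = L_norm M r f"
  by (simp add: L_norm_def)

lemma L_norm_cmult:
  assumes "0 < r"
  shows "L_norm M r (\<lambda>x. c * f x) = norm c * L_norm M r f"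
  using assms by (simp add: L_norm_def norm_mult powr_mult powr_powr)

text \<open>
  Scaling to \<open>a + b = 1\<close> reduces the claim to \<open>x \<le> x ^ t\<close> on \<open>[0, 1]\<close>.
\<close>

lemma powr_add_le:
  fixes a b t :: real
  assumes "0 \<le> a" "0 \<le> b" "0 < t" "t \<le> 1"
  shows "(a + b) powr t \<le> a powr t + b powr t"
proof (cases "a + b = 0")
  case False
  then have pos: "0 < a + b" using assms by auto
  have *: "x / (a + b) \<le> (x / (a + b)) powr t" if "0 \<le> x" "x \<le> a + b" for x
    using powr_mono'[of t 1 "x / (a + b)"] that assms pos by auto
  have "1 = a / (a + b) + b / (a + b)"
    using pos by (simp add: add_divide_distrib[symmetric])
  also have "\<dots> \<le> (a / (a + b)) powr t + (b / (a + b)) powr t"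
    using assms by (intro add_mono *) auto
  also have "\<dots> = (a powr t + b powr t) / (a + b) powr t"
    using assms by (simp add: powr_divide add_divide_distrib)
  finally show ?thesis using pos by (subst (asm) le_divide_eq) auto
qed (use assms in auto)

text \<open>
  Minkowski's inequality up to the factor 2, from \<open>\<bar>a + b\<bar> \<le> 2 max \<bar>a\<bar> \<bar>b\<bar>\<close>. The factor is harmless
  where norms are only compared up to equivalence.
\<close>

lemma L_norm_add_le:
  assumes "1 \<le> r" "f \<in> L_space M r" "g \<in> L_space M r"
  shows "L_norm M r (\<lambda>x. f x + g x) \<le> 2 * (L_norm M r f + L_norm M r g)"
proof -
  let ?I = "\<lambda>f. (\<integral>x. norm (f x) powr r \<partial>M)"
  have r: "0 < r" using assms by simp
  have "?I (\<lambda>x. f x + g x) \<le> (\<integral>x. 2 powr r * (norm (f x) powr r + norm (g x) powr r) \<partial>M)"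
    using assms r L_space_add[OF r assms(2,3)]
    by (intro integral_mono norm_add_powr_le) (auto simp: L_space_def)
  also have "\<dots> = 2 powr r * (?I f + ?I g)"
    using assms by (simp add: L_space_def)
  finally have "L_norm M r (\<lambda>x. f x + g x) \<le> (2 powr r * (?I f + ?I g)) powr (1 / r)"
    unfolding L_norm_def using r by (intro powr_mono2) auto
  also have "\<dots> = 2 * (?I f + ?I g) powr (1 / r)"
    using r by (simp add: powr_mult powr_powr)
  also have "\<dots> \<le> 2 * (L_norm M r f + L_norm M r g)"
    unfolding L_norm_def using assms by (intro mult_left_mono powr_add_le) auto
  finally show ?thesis .
qed

lemma L_norm_diff_le:
  assumes "1 \<le> r" "f \<in> L_space M r" "g \<in> L_space M r"
  shows "L_norm M r (\<lambda>x. f x - g x) \<le> 2 * (L_norm M r f + L_norm M r g)"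
  using L_norm_add_le[OF assms(1,2) L_space_cmult[OF assms(3), of "-1"]]
    L_norm_cmult[of r M "-1" g] assms by simp

lemma L_norm_eq_0_AE:
  assumes "0 < r" "f \<in> L_space M r" "L_norm M r f = 0"
  shows "AE x in M. f x = 0"
proof -
  have "(\<integral>x. norm (f x) powr r \<partial>M) = 0"
    using L_norm_powr[OF assms(1), of M f] assms by simp
  then have "AE x in M. norm (f x) powr r = 0"
    using assms by (subst (asm) integral_nonneg_eq_0_iff_AE) (auto simp: L_space_def)
  then show ?thesis by eventually_elim auto
qed

text \<open>
  Young's inequality, applied to both functions after normalising them to norm 1.
\<close>

lemma Holder:
  assumes "1 < r" "1 < s" "1 / r + 1 / s = 1" and f: "f \<in> L_space M r" and g: "g \<in> L_space M s"
  shows Holder_integrable: "integrable M (\<lambda>x. f x * g x)"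
    and Holder_norm_le: "norm (\<integral>x. f x * g x \<partial>M) \<le> L_norm M r f * L_norm M s g"
proof -
  note [measurable] = L_space_measurable[OF f] L_space_measurable[OF g]
  note fi = L_space_integrable[OF f] and gi = L_space_integrable[OF g]
  have Y: "norm (a * b) \<le> norm a powr r / r + norm b powr s / s" for a b :: complex
    using Youngs_inequality[OF assms(1-3), of "norm a" "norm b"] by (simp add: norm_mult)
  show int: "integrable M (\<lambda>x. f x * g x)"
    by (rule Bochner_Integration.integrable_bound[where f = "\<lambda>x. norm (f x) powr r / r + norm (g x) powr s / s"])
       (use fi gi Y in \<open>auto intro!: AE_I2 intro: order_trans[OF _ abs_ge_self]\<close>)
  define A B where "A = L_norm M r f" and "B = L_norm M s g"
  show "norm (\<integral>x. f x * g x \<partial>M) \<le> A * B"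
  proof (cases "A = 0 \<or> B = 0")
    case True
    then have "AE x in M. f x * g x = 0"
      using L_norm_eq_0_AE[OF _ f] L_norm_eq_0_AE[OF _ g] assms unfolding A_def B_def by fastforce
    then have "(\<integral>x. f x * g x \<partial>M) = 0"
      by (intro integral_eq_zero_AE)
    then show ?thesis by (simp add: A_def B_def)
  next
    case False
    then have pos: "0 < A" "0 < B"
      using L_norm_nonneg[of M r f] L_norm_nonneg[of M s g] unfolding A_def B_def by linarith+
    have Ar: "A powr r = (\<integral>x. norm (f x) powr r \<partial>M)" and Bs: "B powr s = (\<integral>x. norm (g x) powr s \<partial>M)"
      unfolding A_def B_def using assms by (auto intro: L_norm_powr)
    have pt: "norm (f x * g x) \<le> A * B * (norm (f x) powr r / (r * A powr r) + norm (g x) powr s / (s * B powr s))"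
      for x
    proof -
      have "norm (f x * g x) = A * B * norm ((f x / of_real A) * (g x / of_real B))"
        using pos by (simp add: norm_mult norm_divide)
      also have "\<dots> \<le> A * B * (norm (f x / of_real A) powr r / r + norm (g x / of_real B) powr s / s)"
        using pos by (intro mult_left_mono Y) auto
      finally show ?thesis using pos by (simp add: norm_divide powr_divide mult.commute)
    qed
    have "norm (\<integral>x. f x * g x \<partial>M) \<le> (\<integral>x. norm (f x * g x) \<partial>M)"
      by (rule integral_norm_bound)
    also have "\<dots> \<le> (\<integral>x. A * B * (norm (f x) powr r / (r * A powr r) + norm (g x) powr s / (s * B powr s)) \<partial>M)"
      using int fi gi pt by (intro integral_mono) auto
    also have "\<dots> = A * B * (A powr r / (r * A powr r) + B powr s / (s * B powr s))"
      using fi gi by (simp add: Ar Bs)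
    also have "\<dots> = A * B * (1 / r + 1 / s)"
      using pos by simp
    also have "\<dots> = A * B" using assms(3) by simp
    finally show ?thesis .
  qed
qed

text \<open>
  Fatou's lemma for the \<open>r\<close>-th powers. Pointwise convergence alone does not make the limit integrable;
  the common bound \<open>K\<close> does.
\<close>

lemma L_norm_Fatou:
  fixes F :: "nat \<Rightarrow> 'a \<Rightarrow> complex"
  assumes r: "0 < r" and F: "\<And>n. F n \<in> L_space M r" and K: "0 \<le> K" "\<And>n. L_norm M r (F n) \<le> K"
    and lim: "\<And>x. x \<in> space M \<Longrightarrow> (\<lambda>n. F n x) \<longlonglongrightarrow> f x"
  shows "f \<in> L_space M r" "L_norm M r f \<le> K"
proof -
  have [measurable]: "F n \<in> borel_measurable M" for n
    using F by (auto simp: L_space_def)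
  have f[measurable]: "f \<in> borel_measurable M"
    using lim by (rule borel_measurable_LIMSEQ_metric[rotated]) auto
  have "(\<integral>\<^sup>+x. ennreal (norm (f x) powr r) \<partial>M)
      = (\<integral>\<^sup>+x. liminf (\<lambda>n. ennreal (norm (F n x) powr r)) \<partial>M)"
  proof (rule nn_integral_cong)
    fix x assume "x \<in> space M"
    then have "(\<lambda>n. norm (F n x) powr r) \<longlonglongrightarrow> norm (f x) powr r"
      using r by (intro tendsto_powr' tendsto_norm lim tendsto_const) auto
    then show "ennreal (norm (f x) powr r) = liminf (\<lambda>n. ennreal (norm (F n x) powr r))"
      by (intro lim_imp_Liminf[symmetric] tendsto_ennrealI) auto
  qed
  also have "\<dots> \<le> liminf (\<lambda>n. \<integral>\<^sup>+x. ennreal (norm (F n x) powr r) \<partial>M)"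
    by (intro nn_integral_liminf) auto
  also have "\<dots> \<le> liminf (\<lambda>n. ennreal (K powr r))"
  proof (intro Liminf_mono always_eventually allI)
    fix n
    have "(\<integral>\<^sup>+x. ennreal (norm (F n x) powr r) \<partial>M) = ennreal (\<integral>x. norm (F n x) powr r \<partial>M)"
      using F by (intro nn_integral_eq_integral) (auto simp: L_space_def)
    then show "(\<integral>\<^sup>+x. ennreal (norm (F n x) powr r) \<partial>M) \<le> ennreal (K powr r)"
      using K(2)[of n] r K(1) by (simp add: L_norm_le_iff)
  qed
  finally have le: "(\<integral>\<^sup>+x. ennreal (norm (f x) powr r) \<partial>M) \<le> ennreal (K powr r)"
    by (simp add: Liminf_const)
  then have int: "integrable M (\<lambda>x. norm (f x) powr r)"
    by (intro integrableI_bounded) (auto simp: less_top[symmetric] top_unique)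
  then show "f \<in> L_space M r" by (intro L_spaceI f)
  have "ennreal (\<integral>x. norm (f x) powr r \<partial>M) \<le> ennreal (K powr r)"
    using le nn_integral_eq_integral[OF int] by simp
  then show "L_norm M r f \<le> K" using r K by (simp add: L_norm_le_iff)
qed

text \<open>
  On a finite measure space the pointwise bound \<open>y ^ q \<le> 1 + y ^ p\<close> gives the inclusion, and the
  norm estimate after normalising \<open>f\<close> in \<open>L\<^sup>p\<close>.
\<close>

lemma L_space_finite_measure:
  assumes fin: "finite_measure M" and qp: "0 < q" "q \<le> p"
  shows L_space_antimono: "f \<in> L_space M p \<Longrightarrow> f \<in> L_space M q"
    and L_norm_antimono: "\<exists>K>0. \<forall>f\<in>L_space M p. L_norm M q f \<le> K * L_norm M p f"
proof -
  interpret finite_measure M by (rule fin)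
  have pt: "t powr q \<le> 1 + t powr p" if "0 \<le> t" for t :: real
  proof (cases "t \<le> 1")
    case True
    then show ?thesis using powr_mono2[of q t 1] that qp by (auto intro: add_increasing2)
  next
    case False
    then show ?thesis using powr_mono[OF qp(2), of t] by linarith
  qed
  show incl: "f \<in> L_space M q" if "f \<in> L_space M p" for f
    by (rule L_space_mono[where w = "\<lambda>x. 1 + norm (f x) powr p"])
       (use that pt in \<open>auto simp: L_space_def\<close>)
  define V where "V = measure M (space M) + 1"
  have V: "0 < V" by (simp add: V_def add_nonneg_pos)
  have bd: "L_norm M q f \<le> V powr (1 / q) * L_norm M p f" if f: "f \<in> L_space M p" for f
  proof (cases "L_norm M p f = 0")
    case True
    then have *: "AE x in M. f x = 0" using f qp by (intro L_norm_eq_0_AE[of p]) auto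
    have "(\<integral>x. norm (f x) powr q \<partial>M) = 0"
      by (rule integral_eq_zero_AE) (use * in \<open>eventually_elim, simp\<close>)
    then show ?thesis by (simp add: L_norm_def)
  next
    case False
    define A where "A = L_norm M p f"
    have A: "0 < A" using False L_norm_nonneg[of M p f] by (simp add: A_def less_le)
    define g where "g = (\<lambda>x. inverse (complex_of_real A) * f x)"
    have g: "g \<in> L_space M p" unfolding g_def by (rule L_space_cmult[OF f])
    have "L_norm M p g = 1"
      using A qp by (simp add: g_def L_norm_cmult norm_inverse A_def[symmetric])
    then have g1: "(\<integral>x. norm (g x) powr p \<partial>M) = 1"
      using L_norm_powr[of p M g] qp by simp
    have "(\<integral>x. norm (g x) powr q \<partial>M) \<le> (\<integral>x. 1 + norm (g x) powr p \<partial>M)"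
      using incl[OF g] g pt by (intro integral_mono) (auto simp: L_space_def)
    also have "\<dots> = V"
      using g g1 by (simp add: L_space_def V_def)
    finally have "L_norm M q g \<le> V powr (1 / q)"
      unfolding L_norm_def using qp by (intro powr_mono2) auto
    moreover have "L_norm M q f = A * L_norm M q g"
      using A qp by (simp add: g_def L_norm_cmult norm_inverse)
    ultimately show ?thesis using A by (simp add: A_def mult.commute mult_left_mono)
  qed
  show "\<exists>K>0. \<forall>f\<in>L_space M p. L_norm M q f \<le> K * L_norm M p f"
    using bd V by (intro exI[of _ "V powr (1 / q)"]) auto
qed

section \<open>The mean value property and point evaluations\<close>

lemma nn_integral_lborel_translate:
  fixes h :: "'a::euclidean_space \<Rightarrow> ennreal"
  assumes [measurable]: "h \<in> borel_measurable borel"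
  shows "(\<integral>\<^sup>+x. h (x + c) \<partial>lborel) = (\<integral>\<^sup>+x. h x \<partial>lborel)"
proof -
  have "(\<integral>\<^sup>+x. h x \<partial>lborel) = (\<integral>\<^sup>+x. h x \<partial>distr lborel borel ((+) c))"
    by (simp add: lborel_distr_plus)
  also have "\<dots> = (\<integral>\<^sup>+x. h (x + c) \<partial>lborel)"
    by (subst nn_integral_distr) (auto simp: add.commute)
  finally show ?thesis by simp
qed

text \<open>
  Uniqueness of translation-invariant measures, in the form given by Tonelli's theorem. With \<open>B\<close> the
  unit ball, the double integral of \<open>1\<^sub>B(y) h(T x + y)\<close> is evaluated in both orders. Integrating over
  \<open>x\<close> first, translation invariance removes \<open>y\<close> and leaves \<open>\<bar>B\<bar> \<integral> h (T x) dx\<close>. Substituting \<open>y - T x\<close>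
  for \<open>y\<close> before the integration over \<open>x\<close> leaves \<open>\<bar>B\<bar> \<integral> h\<close>, because \<open>1\<^sub>B(y - T x)\<close> is, as a function of \<open>x\<close>, the
  indicator of a translate of \<open>B\<close>.
\<close>

lemma nn_integral_lborel_isometry:
  fixes h :: "'a::euclidean_space \<Rightarrow> ennreal" and T :: "'a \<Rightarrow> 'a"
  assumes h[measurable]: "h \<in> borel_measurable borel" and T: "linear T" "\<And>x. norm (T x) = norm x"
  shows "(\<integral>\<^sup>+x. h (T x) \<partial>lborel) = (\<integral>\<^sup>+x. h x \<partial>lborel)"
proof -
  define B where "B = ball (0::'a) 1"
  have [measurable]: "B \<in> sets borel" by (simp add: B_def)
  have [measurable]: "T \<in> borel_measurable borel"
    using T(1)[unfolded linear_conv_bounded_linear]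
    by (rule borel_measurable_continuous_onI[OF linear_continuous_on])
  have "inj T"
    using T(2) unfolding linear_injective_0[OF T(1)] by (metis norm_eq_zero)
  then have "surj T" using T(1) by (intro linear_injective_imp_surjective) auto
  then obtain S where S: "\<And>x. T (S x) = x" by (metis surjD)
  have "(\<integral>\<^sup>+y. indicator B y \<partial>lborel) * (\<integral>\<^sup>+x. h (T x) \<partial>lborel)
      = (\<integral>\<^sup>+y. (\<integral>\<^sup>+x. indicator B y * h (T x) \<partial>lborel) \<partial>lborel)"
    by (simp add: nn_integral_cmult nn_integral_multc)
  also have "\<dots> = (\<integral>\<^sup>+y. (\<integral>\<^sup>+x. indicator B y * h (T x + y) \<partial>lborel) \<partial>lborel)"
  proof (rule nn_integral_cong)
    fix y
    have "T x + y = T (x + S y)" for x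
      using T(1) S by (simp add: linear_add)
    then show "(\<integral>\<^sup>+x. indicator B y * h (T x) \<partial>lborel) = (\<integral>\<^sup>+x. indicator B y * h (T x + y) \<partial>lborel)"
      using nn_integral_lborel_translate[of "\<lambda>x. indicator B y * h (T x)" "S y"] by simp
  qed
  also have "\<dots> = (\<integral>\<^sup>+x. (\<integral>\<^sup>+y. indicator B y * h (T x + y) \<partial>lborel) \<partial>lborel)"
    by (rule lborel_pair.Fubini') measurable
  also have "\<dots> = (\<integral>\<^sup>+x. (\<integral>\<^sup>+y. indicator B (y - T x) * h y \<partial>lborel) \<partial>lborel)"
  proof (rule nn_integral_cong)
    fix x
    show "(\<integral>\<^sup>+y. indicator B y * h (T x + y) \<partial>lborel) = (\<integral>\<^sup>+y. indicator B (y - T x) * h y \<partial>lborel)"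
      using nn_integral_lborel_translate[of "\<lambda>y. indicator B (y - T x) * h y" "T x"]
      by (simp add: add.commute)
  qed
  also have "\<dots> = (\<integral>\<^sup>+y. (\<integral>\<^sup>+x. indicator B (y - T x) * h y \<partial>lborel) \<partial>lborel)"
    by (rule lborel_pair.Fubini'[symmetric]) measurable
  also have "\<dots> = (\<integral>\<^sup>+y. (\<integral>\<^sup>+x. indicator B x * h y \<partial>lborel) \<partial>lborel)"
  proof (rule nn_integral_cong)
    fix y
    have "norm (y - T x) = norm (x - S y)" for x
      using T(2)[of "x - S y"] S[of y] T(1) by (simp add: linear_diff norm_minus_commute)
    then have "indicator B (y - T x) = (indicator B (x + - S y) :: ennreal)" for x
      by (simp add: B_def indicator_def)
    then show "(\<integral>\<^sup>+x. indicator B (y - T x) * h y \<partial>lborel) = (\<integral>\<^sup>+x. indicator B x * h y \<partial>lborel)"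
      using nn_integral_lborel_translate[of "\<lambda>x. indicator B x * h y" "- S y"] by simp
  qed
  also have "\<dots> = (\<integral>\<^sup>+y. indicator B y \<partial>lborel) * (\<integral>\<^sup>+x. h x \<partial>lborel)"
    by (simp add: nn_integral_cmult nn_integral_multc)
  finally have eq: "emeasure lborel B * (\<integral>\<^sup>+x. h (T x) \<partial>lborel) = emeasure lborel B * (\<integral>\<^sup>+x. h x \<partial>lborel)"
    by simp
  have "emeasure lborel B \<noteq> top"
    using emeasure_lborel_ball_finite[of "0::'a" 1] by (simp add: B_def)
  moreover have "emeasure lborel B \<noteq> 0"
    using content_ball_pos[of 1 "0::'a"] unfolding B_def measure_def by fastforce
  ultimately show ?thesis
    using eq by (simp add: ennreal_mult_cancel_left)
qed

lemma norm_vector_smult: "norm (c *s (v :: complex ^ 'n)) = norm c * norm v"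
  by (simp add: norm_vec_def norm_mult L2_set_right_distrib)

lemma linear_vector_smult: "linear (\<lambda>v :: complex ^ 'n. c *s v)"
  by (rule linearI) (simp_all add: vec_eq_iff algebra_simps)

lemma bounded_linear_vector_smult_left: "bounded_linear (\<lambda>c. c *s (v :: complex ^ 'n))"
  by (rule bounded_linear_intro[where K = "norm v"])
     (simp_all add: vec_eq_iff norm_vector_smult algebra_simps)

lemma holomorphic_in_continuous_on: "holomorphic_in \<Omega> f \<Longrightarrow> continuous_on \<Omega> f"
  unfolding holomorphic_in_def
  by (metis continuous_at_imp_continuous_on has_derivative_continuous)

text \<open>
  Restriction to a complex line reduces holomorphy in several variables to one variable.
\<close>

lemma holomorphic_in_line:
  assumes f: "holomorphic_in \<Omega> f" and A: "\<And>\<zeta>. \<zeta> \<in> A \<Longrightarrow> z + \<zeta> *s v \<in> \<Omega>"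
  shows "(\<lambda>\<zeta>. f (z + \<zeta> *s v)) holomorphic_on A"
  unfolding holomorphic_on_def field_differentiable_def
proof
  fix \<zeta> assume "\<zeta> \<in> A"
  then obtain D where D: "(f has_derivative D) (at (z + \<zeta> *s v))" "\<And>c v. D (c *s v) = c * D v"
    using f A unfolding holomorphic_in_def by blast
  have "((\<lambda>\<zeta>. z + \<zeta> *s v) has_derivative (\<lambda>h. h *s v)) (at \<zeta> within A)"
    using bounded_linear_imp_has_derivative[OF bounded_linear_vector_smult_left[of v]]
    by (auto intro!: derivative_eq_intros)
  then have "((\<lambda>\<zeta>. f (z + \<zeta> *s v)) has_derivative (\<lambda>h. D (h *s v))) (at \<zeta> within A)"
    using D(1) by (rule has_derivative_compose)
  then show "\<exists>f'. ((\<lambda>\<zeta>. f (z + \<zeta> *s v)) has_field_derivative f') (at \<zeta> within A)"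
    unfolding has_field_derivative_def using D(2) by (metis (no_types, lifting) ext mult.commute)
qed

text \<open>
  Cauchy's integral formula on the unit circle. The mean is a nonnegative integral, so that Tonelli's
  theorem applies to it without integrability conditions.
\<close>

lemma norm_center_le_circle_mean:
  assumes "\<phi> holomorphic_on cball 0 1"
  shows "ennreal (norm (\<phi> 0)) \<le> (\<integral>\<^sup>+t. indicator {0..1} t * ennreal (norm (\<phi> (exp (2 * of_real pi * \<i> * of_real t)))) \<partial>lborel)"
proof -
  define e where "e = (\<lambda>t::real. exp (2 * complex_of_real pi * \<i> * of_real t))"
  have e[simp]: "norm (e t) = 1" "e t \<noteq> 0" for t
    by (simp_all add: e_def)
  have circ: "circlepath 0 1 t = e t" for t
    by (simp add: circlepath e_def)
  have cont: "continuous_on {0..1} (\<lambda>t. \<phi> (e t))"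
    unfolding e_def using assms
    by (intro continuous_on_compose2[OF holomorphic_on_imp_continuous_on[OF assms]] continuous_intros)
       auto
  have "((\<lambda>u. \<phi> u / (u - 0)) has_contour_integral (2 * of_real pi * \<i> * \<phi> 0)) (circlepath 0 1)"
    by (rule Cauchy_integral_circlepath_simple[OF assms]) simp
  then have "((\<lambda>t. \<phi> (e t) / e t * (2 * pi * \<i> * e t)) has_integral (2 * of_real pi * \<i> * \<phi> 0)) {0..1}"
    unfolding has_contour_integral
    by (rule has_integral_eq[rotated]) (simp add: vector_derivative_circlepath vector_derivative_circlepath01 circ, simp add: e_def)
  note I = has_integral_mult_right[OF this, of "1 / (2 * pi * \<i>)"]
  have "1 / (2 * pi * \<i>) * (\<phi> (e t) / e t * (2 * pi * \<i> * e t)) = \<phi> (e t)" for t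
    by simp
  moreover have "1 / (2 * pi * \<i>) * (2 * of_real pi * \<i> * \<phi> 0) = \<phi> 0"
    by simp
  ultimately have "((\<lambda>t. \<phi> (e t)) has_integral \<phi> 0) {0..1}"
    using I by (simp only:)
  moreover have si: "set_integrable lborel {0..1} (\<lambda>t. \<phi> (e t))"
    by (rule borel_integrable_atLeastAtMost'[OF cont])
  ultimately have "(LINT t:{0..1}|lborel. \<phi> (e t)) = \<phi> 0"
    using set_borel_integral_eq_integral(2)[OF si] integral_unique by metis
  then have "ennreal (norm (\<phi> 0)) \<le> (\<integral>\<^sup>+t. norm (indicator {0..1} t *\<^sub>R \<phi> (e t)) \<partial>lborel)"
    using integral_norm_bound_ennreal[OF si[unfolded set_integrable_def]]
    by (simp add: set_lebesgue_integral_def)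
  also have "\<dots> = (\<integral>\<^sup>+t. indicator {0..1} t * ennreal (norm (\<phi> (e t))) \<partial>lborel)"
    by (intro nn_integral_cong) (simp split: split_indicator)
  finally show ?thesis by (simp add: e_def)
qed

text \<open>
  On a ball around \<open>z\<close> inside \<open>\<Omega>\<close>, the value at \<open>z\<close> is controlled by the mean over the circle
  \<open>{z + e\<^sup>i\<^sup>t v}\<close> for every \<open>v\<close>. Averaging over \<open>v\<close> and exchanging the integrals makes the angle
  disappear, since multiplication by \<open>e\<^sup>i\<^sup>t\<close> preserves Lebesgue measure.
\<close>

lemma point_evaluation_L1:
  fixes \<Omega> :: "(complex ^ 'n) set"
  assumes \<Omega>: "open \<Omega>" and z: "z \<in> \<Omega>"
  shows "\<exists>C. \<forall>f. holomorphic_in \<Omega> f \<longrightarrow> f \<in> L_space (restrict_space lborel \<Omega>) 1 \<longrightarrow>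
           norm (f z) \<le> C * L_norm (restrict_space lborel \<Omega>) 1 f"
proof -
  obtain \<rho> where \<rho>: "0 < \<rho>" "cball z \<rho> \<subseteq> \<Omega>"
    using \<Omega> z open_contains_cball by blast
  define B where "B = ball (0 :: complex ^ 'n) \<rho>"
  have [measurable]: "B \<in> sets borel" by (simp add: B_def)
  have Bpos: "0 < measure lborel B" and Bfin: "emeasure lborel B < \<infinity>"
    using content_ball_pos[OF \<rho>(1)] emeasure_lborel_ball_finite by (auto simp: B_def)
  define e where "e = (\<lambda>t::real. exp (2 * complex_of_real pi * \<i> * of_real t))"
  have ne: "norm (e t) = 1" for t by (simp add: e_def)
  have [measurable]: "e \<in> borel_measurable borel"
    unfolding e_def by (intro borel_measurable_continuous_onI continuous_intros)
  have [measurable]: "(\<lambda>(t, v). z + e t *s v) \<in> borel_measurable (borel \<Otimes>\<^sub>M borel)"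
    unfolding e_def borel_prod vector_scalar_mult_def case_prod_beta
    by (intro borel_measurable_continuous_onI continuous_intros)
  show ?thesis
  proof (intro exI[of _ "1 / measure lborel B"] allI impI)
    fix f :: "complex ^ 'n \<Rightarrow> complex"
    assume hol: "holomorphic_in \<Omega> f" and f: "f \<in> L_space (restrict_space lborel \<Omega>) 1"
    define W where "W = (\<lambda>x. ennreal (norm (indicator \<Omega> x *\<^sub>R f x)))"
    have "(\<lambda>x. indicator \<Omega> x *\<^sub>R f x) \<in> borel_measurable borel"
      using holomorphic_in_continuous_on[OF hol] \<Omega>
      by (intro borel_measurable_continuous_on_indicator) auto
    then have W[measurable]: "W \<in> borel_measurable borel" unfolding W_def by measurable
    have pt: "indicator B v * ennreal (norm (f z))
        \<le> (\<integral>\<^sup>+t. indicator B v * (indicator {0..1} t * W (z + e t *s v)) \<partial>lborel)" for v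
    proof (cases "v \<in> B")
      case True
      have in\<Omega>: "z + \<zeta> *s v \<in> \<Omega>" if "\<zeta> \<in> cball 0 1" for \<zeta>
      proof -
        have "norm (\<zeta> *s v) \<le> 1 * \<rho>"
          unfolding norm_vector_smult using that True by (intro mult_mono) (auto simp: B_def)
        then have "z + \<zeta> *s v \<in> cball z \<rho>" by (simp add: dist_norm)
        then show ?thesis using \<rho>(2) by blast
      qed
      have "ennreal (norm (f z)) \<le> (\<integral>\<^sup>+t. indicator {0..1} t * ennreal (norm (f (z + e t *s v))) \<partial>lborel)"
        using norm_center_le_circle_mean[OF holomorphic_in_line[OF hol in\<Omega>]] by (simp add: e_def)
      also have "\<dots> = (\<integral>\<^sup>+t. indicator {0..1} t * W (z + e t *s v) \<partial>lborel)"
        using in\<Omega> ne by (intro nn_integral_cong) (simp add: W_def)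
      finally show ?thesis using True by simp
    qed simp
    have "emeasure lborel B * ennreal (norm (f z)) = (\<integral>\<^sup>+v. indicator B v * ennreal (norm (f z)) \<partial>lborel)"
      by (simp add: nn_integral_multc)
    also have "\<dots> \<le> (\<integral>\<^sup>+v. (\<integral>\<^sup>+t. indicator B v * (indicator {0..1} t * W (z + e t *s v)) \<partial>lborel) \<partial>lborel)"
      by (intro nn_integral_mono pt)
    also have "\<dots> = (\<integral>\<^sup>+t. (\<integral>\<^sup>+v. indicator B v * (indicator {0..1} t * W (z + e t *s v)) \<partial>lborel) \<partial>lborel)"
      by (rule lborel_pair.Fubini') measurable
    also have "\<dots> \<le> (\<integral>\<^sup>+t. indicator {0..1::real} t * (\<integral>\<^sup>+x. W x \<partial>lborel) \<partial>lborel)"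
    proof (intro nn_integral_mono)
      fix t :: real
      have "(\<integral>\<^sup>+v. indicator B v * (indicator {0..1} t * W (z + e t *s v)) \<partial>lborel)
          \<le> (\<integral>\<^sup>+v. indicator {0..1} t * W (z + e t *s v) \<partial>lborel)"
        by (intro nn_integral_mono) (simp split: split_indicator)
      also have "\<dots> = (\<integral>\<^sup>+v. indicator {0..1} t * W (z + v) \<partial>lborel)"
        by (rule nn_integral_lborel_isometry[where T = "\<lambda>v. e t *s v" and h = "\<lambda>v. indicator {0..1} t * W (z + v)"])
           (auto simp: norm_vector_smult ne linear_vector_smult)
      also have "\<dots> = indicator {0..1} t * (\<integral>\<^sup>+v. W (v + z) \<partial>lborel)"
        by (simp add: nn_integral_cmult add.commute)
      also have "\<dots> = indicator {0..1} t * (\<integral>\<^sup>+x. W x \<partial>lborel)"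
        by (subst nn_integral_lborel_translate) auto
      finally show "(\<integral>\<^sup>+v. indicator B v * (indicator {0..1} t * W (z + e t *s v)) \<partial>lborel)
          \<le> indicator {0..1} t * (\<integral>\<^sup>+x. W x \<partial>lborel)" .
    qed
    also have "\<dots> = (\<integral>\<^sup>+x. W x \<partial>lborel)"
      by (simp add: nn_integral_multc)
    also have "\<dots> = (\<integral>\<^sup>+x. ennreal (norm (f x)) \<partial>restrict_space lborel \<Omega>)"
      using \<Omega> by (subst nn_integral_restrict_space)
        (auto intro!: nn_integral_cong simp: W_def split: split_indicator)
    also have "\<dots> = ennreal (L_norm (restrict_space lborel \<Omega>) 1 f)"
      using f by (subst nn_integral_eq_integral) (auto simp: L_space_def L_norm_def)
    finally have "ennreal (measure lborel B * norm (f z)) \<le> ennreal (L_norm (restrict_space lborel \<Omega>) 1 f)"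
      using Bfin by (simp add: emeasure_eq_ennreal_measure ennreal_mult)
    then show "norm (f z) \<le> 1 / measure lborel B * L_norm (restrict_space lborel \<Omega>) 1 f"
      using Bpos by (simp add: field_simps)
  qed
qed

section \<open>Bergman spaces and their duality pairing\<close>

text \<open>
  Integrals over \<open>\<Omega>\<close> are expressed as integrals with respect to the restricted measure, which is
  finite for bounded \<open>\<Omega>\<close>.
\<close>

abbreviation lborel_on :: "(complex ^ 'n) set \<Rightarrow> (complex ^ 'n) measure" where
  "lborel_on \<Omega> \<equiv> restrict_space lborel \<Omega>"

abbreviation bergman :: "(complex ^ 'n) set \<Rightarrow> real \<Rightarrow> (complex ^ 'n \<Rightarrow> complex) set" where
  "bergman \<Omega> r \<equiv> fcarrier (bergman_space \<Omega> r)"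

lemma in_Lr_iff: "open \<Omega> \<Longrightarrow> in_Lr \<Omega> r f \<longleftrightarrow> f \<in> L_space (lborel_on \<Omega>) r"
  by (simp add: in_Lr_def L_space_def set_borel_measurable_def set_integrable_def
      borel_measurable_restrict_space_iff integrable_restrict_space)

lemma fnorm_bergman: "open \<Omega> \<Longrightarrow> fnorm (bergman_space \<Omega> r) = L_norm (lborel_on \<Omega>) r"
  by (simp add: fun_eq_iff bergman_space_def Lr_norm_def L_norm_def set_lebesgue_integral_def
      integral_restrict_space)

lemma pairing_eq: "open \<Omega> \<Longrightarrow> pairing \<Omega> f g = (\<integral>z. f z * cnj (g z) \<partial>lborel_on \<Omega>)"
  by (simp add: pairing_def set_lebesgue_integral_def integral_restrict_space)

lemma bergman_iff:
  "open \<Omega> \<Longrightarrow> f \<in> bergman \<Omega> r \<longleftrightarrow>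
     f \<in> L_space (lborel_on \<Omega>) r \<and> holomorphic_in \<Omega> f \<and> (\<forall>z. z \<notin> \<Omega> \<longrightarrow> f z = 0)"
  by (simp add: bergman_space_def in_Lr_iff)

lemma holomorphic_in_add:
  assumes "holomorphic_in \<Omega> f" "holomorphic_in \<Omega> g"
  shows "holomorphic_in \<Omega> (\<lambda>z. f z + g z)"
  unfolding holomorphic_in_def
proof
  fix z assume "z \<in> \<Omega>"
  then obtain D E where "(f has_derivative D) (at z)" "\<forall>c v. D (c *s v) = c * D v"
    "(g has_derivative E) (at z)" "\<forall>c v. E (c *s v) = c * E v"
    using assms unfolding holomorphic_in_def by meson
  then show "\<exists>D. ((\<lambda>z. f z + g z) has_derivative D) (at z) \<and> (\<forall>c v. D (c *s v) = c * D v)"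
    by (intro exI[of _ "\<lambda>v. D v + E v"]) (auto intro: has_derivative_add simp: ring_distribs)
qed

lemma holomorphic_in_cmult:
  assumes "holomorphic_in \<Omega> f"
  shows "holomorphic_in \<Omega> (\<lambda>z. a * f z)"
  unfolding holomorphic_in_def
proof
  fix z assume "z \<in> \<Omega>"
  then obtain D where "(f has_derivative D) (at z)" "\<forall>c v. D (c *s v) = c * D v"
    using assms unfolding holomorphic_in_def by meson
  then show "\<exists>D. ((\<lambda>z. a * f z) has_derivative D) (at z) \<and> (\<forall>c v. D (c *s v) = c * D v)"
    by (intro exI[of _ "\<lambda>v. a * D v"]) (auto intro: has_derivative_mult_right)
qed

lemma zero_in_bergman: "open \<Omega> \<Longrightarrow> (\<lambda>z. 0) \<in> bergman \<Omega> r"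
  by (auto simp: bergman_iff L_space_def holomorphic_in_def intro!: exI[of _ "\<lambda>v. 0"])

lemma bergman_add:
  "\<lbrakk>open \<Omega>; 0 < r; f \<in> bergman \<Omega> r; g \<in> bergman \<Omega> r\<rbrakk> \<Longrightarrow> (\<lambda>z. f z + g z) \<in> bergman \<Omega> r"
  by (simp add: bergman_iff L_space_add holomorphic_in_add)

lemma bergman_cmult:
  "\<lbrakk>open \<Omega>; f \<in> bergman \<Omega> r\<rbrakk> \<Longrightarrow> (\<lambda>z. c * f z) \<in> bergman \<Omega> r"
  by (simp add: bergman_iff L_space_cmult holomorphic_in_cmult)

lemma bergman_diff:
  assumes "open \<Omega>" "0 < r" "f \<in> bergman \<Omega> r" "g \<in> bergman \<Omega> r"
  shows "(\<lambda>z. f z - g z) \<in> bergman \<Omega> r"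
  using bergman_add[OF assms(1-3) bergman_cmult[OF assms(1,4), of "-1"]] by simp

lemma finite_measure_lborel_on:
  fixes \<Omega> :: "(complex ^ 'n) set"
  assumes "open \<Omega>" "bounded \<Omega>"
  shows "finite_measure (lborel_on \<Omega>)"
proof (rule finite_measureI)
  have "emeasure lborel \<Omega> < \<infinity>"
    by (rule emeasure_bounded_finite[OF assms(2)])
  then show "emeasure (lborel_on \<Omega>) (space (lborel_on \<Omega>)) \<noteq> \<infinity>"
    using assms(1) by (simp add: emeasure_restrict_space space_restrict_space)
qed

lemma bergman_antimono:
  assumes "open \<Omega>" "bounded \<Omega>" "0 < q" "q \<le> p" "f \<in> bergman \<Omega> p"
  shows "f \<in> bergman \<Omega> q"
  using L_space_antimono[OF finite_measure_lborel_on[OF assms(1,2)] assms(3,4)] assms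
  by (simp add: bergman_iff)

lemma bergman_point_evaluation:
  fixes \<Omega> :: "(complex ^ 'n) set"
  assumes \<Omega>: "open \<Omega>" "bounded \<Omega>" and r: "1 \<le> r" and z: "z \<in> \<Omega>"
  shows "\<exists>C. \<forall>f\<in>bergman \<Omega> r. norm (f z) \<le> C * L_norm (lborel_on \<Omega>) r f"
proof -
  note fm = finite_measure_lborel_on[OF \<Omega>]
  obtain C where C: "\<And>f. holomorphic_in \<Omega> f \<Longrightarrow> f \<in> L_space (lborel_on \<Omega>) 1 \<Longrightarrow>
      norm (f z) \<le> C * L_norm (lborel_on \<Omega>) 1 f"
    using point_evaluation_L1[OF \<Omega>(1) z] by blast
  obtain K where K: "K > 0" "\<And>f. f \<in> L_space (lborel_on \<Omega>) r \<Longrightarrow>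
      L_norm (lborel_on \<Omega>) 1 f \<le> K * L_norm (lborel_on \<Omega>) r f"
    using L_norm_antimono[OF fm _ r] by auto
  show ?thesis
  proof (intro exI[of _ "\<bar>C\<bar> * K"] ballI)
    fix f assume f: "f \<in> bergman \<Omega> r"
    then have fL: "f \<in> L_space (lborel_on \<Omega>) r" "holomorphic_in \<Omega> f"
      using \<Omega> by (auto simp: bergman_iff)
    have "norm (f z) \<le> C * L_norm (lborel_on \<Omega>) 1 f"
      using L_space_antimono[OF fm _ r] fL by (intro C) auto
    also have "\<dots> \<le> \<bar>C\<bar> * (K * L_norm (lborel_on \<Omega>) r f)"
      using K(2)[OF fL(1)] by (intro mult_mono) auto
    finally show "norm (f z) \<le> \<bar>C\<bar> * K * L_norm (lborel_on \<Omega>) r f" by (simp add: mult.assoc)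
  qed
qed

lemma Phi_surjectiveD:
  assumes "Phi_surjective \<Omega> r s" and \<Omega>: "open \<Omega>" and r: "0 < r"
    and add: "\<And>f g. f \<in> bergman \<Omega> r \<Longrightarrow> g \<in> bergman \<Omega> r \<Longrightarrow> L (\<lambda>z. f z + g z) = L f + L g"
    and cmult: "\<And>c f. f \<in> bergman \<Omega> r \<Longrightarrow> L (\<lambda>z. c * f z) = c * L f"
    and bound: "\<And>f. f \<in> bergman \<Omega> r \<Longrightarrow> norm (L f) \<le> B * L_norm (lborel_on \<Omega>) r f"
  shows "\<exists>g\<in>bergman \<Omega> s. \<forall>f\<in>bergman \<Omega> r. L f = pairing \<Omega> f g"
proof -
  have "restrict L (bergman \<Omega> r) \<in> dual_space (bergman_space \<Omega> r)"
    using add cmult bound bergman_add[OF \<Omega> r] bergman_cmult[OF \<Omega>]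
    unfolding dual_space_def by (auto simp: fnorm_bergman[OF \<Omega>] intro!: exI[of _ B])
  then obtain g where g: "g \<in> bergman \<Omega> s" "Phi \<Omega> r g = restrict L (bergman \<Omega> r)"
    using assms(1) unfolding Phi_surjective_def by blast
  have "L f = pairing \<Omega> f g" if "f \<in> bergman \<Omega> r" for f
    using fun_cong[OF g(2), of f] that by (simp add: Phi_def)
  then show ?thesis using g(1) by blast
qed

lemma pairing_integrable:
  assumes "1 < r" "1 < s" "1 / r + 1 / s = 1" "f \<in> L_space (lborel_on \<Omega>) r" "g \<in> L_space (lborel_on \<Omega>) s"
  shows "integrable (lborel_on \<Omega>) (\<lambda>z. f z * cnj (g z))"
  using Holder_integrable[OF assms(1-4) L_space_cnj[OF assms(5)]] .

lemma norm_pairing_le: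
  assumes "open \<Omega>" "1 < r" "1 < s" "1 / r + 1 / s = 1"
    "f \<in> L_space (lborel_on \<Omega>) r" "g \<in> L_space (lborel_on \<Omega>) s"
  shows "norm (pairing \<Omega> f g) \<le> L_norm (lborel_on \<Omega>) r f * L_norm (lborel_on \<Omega>) s g"
  using Holder_norm_le[OF assms(2-5) L_space_cnj[OF assms(6)]] assms(1) by (simp add: pairing_eq)

lemma pairing_swap: "open \<Omega> \<Longrightarrow> pairing \<Omega> g f = cnj (pairing \<Omega> f g)"
  using Bochner_Integration.integral_cnj[of "lborel_on \<Omega>" "\<lambda>z. f z * cnj (g z)"] by (simp add: pairing_eq mult.commute)

lemma pairing_add_left:
  assumes "open \<Omega>" "1 < r" "1 < s" "1 / r + 1 / s = 1" "f \<in> L_space (lborel_on \<Omega>) r"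
    "g \<in> L_space (lborel_on \<Omega>) r" "h \<in> L_space (lborel_on \<Omega>) s"
  shows "pairing \<Omega> (\<lambda>z. f z + g z) h = pairing \<Omega> f h + pairing \<Omega> g h"
  using pairing_integrable[OF assms(2-5,7)] pairing_integrable[OF assms(2-4,6,7)] assms(1)
  by (simp add: pairing_eq ring_distribs)

lemma pairing_cmult_left: "open \<Omega> \<Longrightarrow> pairing \<Omega> (\<lambda>z. c * f z) h = c * pairing \<Omega> f h"
  by (simp add: pairing_eq mult.assoc)

lemma pairing_diff_right:
  assumes "open \<Omega>" "1 < r" "1 < s" "1 / r + 1 / s = 1" "f \<in> L_space (lborel_on \<Omega>) r"
    "g \<in> L_space (lborel_on \<Omega>) s" "h \<in> L_space (lborel_on \<Omega>) s"
  shows "pairing \<Omega> f (\<lambda>z. g z - h z) = pairing \<Omega> f g - pairing \<Omega> f h"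
  using pairing_integrable[OF assms(2-6)] pairing_integrable[OF assms(2-5,7)] assms(1)
  by (simp add: pairing_eq ring_distribs)

section \<open>Boundedness of the inverse of the duality map\<close>

text \<open>
  Only upper bounds for the norm of the functional \<open>\<langle>\<cdot>, g\<rangle>\<close> matter, so the dual norm itself is not introduced
  as a number.
\<close>

definition dual_bound ::
  "(complex ^ 'n) set \<Rightarrow> real \<Rightarrow> (complex ^ 'n \<Rightarrow> complex) \<Rightarrow> real \<Rightarrow> bool" where
  "dual_bound \<Omega> r g e \<longleftrightarrow> (\<forall>f\<in>bergman \<Omega> r. norm (pairing \<Omega> f g) \<le> e * L_norm (lborel_on \<Omega>) r f)"

text \<open>
  If the claim fails, then arbitrarily close (in the dual norm) to every \<open>h\<close> there are elements of
  arbitrarily large \<open>L\<^sup>s\<close> norm. On the other hand, the sets where the \<open>L\<^sup>s\<close> norm exceeds a constant are open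
  in the dual norm: the kernels turn convergence in the dual norm into pointwise convergence, and Fatou's
  lemma applies. So nested balls can be chosen such that the \<open>L\<^sup>s\<close> norm exceeds \<open>n\<close> on the \<open>n\<close>-th ball.
  The centres converge in the dual space, surjectivity represents the limit by an element of \<open>A\<^sup>s\<close>, and its
  norm exceeds every \<open>n\<close>.
\<close>

lemma Phi_inverse_bounded:
  fixes \<Omega> :: "(complex ^ 'n) set"
  assumes \<Omega>: "open \<Omega>" and rs: "1 < r" "1 < s" "1 / r + 1 / s = 1"
    and surj: "Phi_surjective \<Omega> r s"
    and kernel: "\<And>z. z \<in> \<Omega> \<Longrightarrow> \<exists>k\<in>bergman \<Omega> r. \<forall>g\<in>bergman \<Omega> s. g z = pairing \<Omega> g k"
  shows "\<exists>C>0. \<forall>g\<in>bergman \<Omega> s. \<forall>e>0. dual_bound \<Omega> r g e \<longrightarrow> L_norm (lborel_on \<Omega>) s g \<le> C * e"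
proof (rule ccontr)
  let ?A = "bergman \<Omega> s"
  let ?N = "L_norm (lborel_on \<Omega>) s"
  let ?M = "L_norm (lborel_on \<Omega>) r"
  let ?D = "dual_bound \<Omega> r"
  have L: "g \<in> L_space (lborel_on \<Omega>) s" if "g \<in> ?A" for g
    using that \<Omega> by (simp add: bergman_iff)
  have Lr: "f \<in> L_space (lborel_on \<Omega>) r" if "f \<in> bergman \<Omega> r" for f
    using that \<Omega> by (simp add: bergman_iff)
  have s0: "0 < s" "1 \<le> s" "0 < r" using rs by auto
  have diffA: "(\<lambda>z. g z - h z) \<in> ?A" if "g \<in> ?A" "h \<in> ?A" for g h
    using bergman_diff[OF \<Omega> s0(1) that] .
  assume "\<not> ?thesis"
  then have neg: "\<exists>g\<in>?A. \<exists>e>0. ?D g e \<and> C * e < ?N g" if "0 < C" for C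
    using that by (meson not_le)
  have big: "\<exists>h\<in>?A. ?D (\<lambda>z. h z - g z) e \<and> K < ?N h" if g: "g \<in> ?A" and e: "0 < e" and K: "0 \<le> K" for g e K
  proof -
    \<comment> \<open>The element \<open>v\<close> below has dual norm at most \<open>e\<close> and \<open>L\<^sup>s\<close> norm above \<open>2 (K + N g)\<close>, so the
      quasi-triangle inequality forces the norm of \<open>g + v\<close> above \<open>K\<close>.\<close>
    define C where "C = (2 * (K + ?N g) + 1) / e"
    have "0 < C" using K e by (simp add: C_def add_nonneg_pos)
    then obtain u d where u: "u \<in> ?A" "0 < d" "?D u d" "C * d < ?N u"
      using neg by blast
    define v where "v = (\<lambda>z. complex_of_real (e / d) * u z)"
    have v: "v \<in> ?A" unfolding v_def by (rule bergman_cmult[OF \<Omega> u(1)])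
    have nv: "?N v = e / d * ?N u"
      using e u(2) s0 unfolding v_def by (subst L_norm_cmult) (auto simp: norm_divide)
    have pv: "pairing \<Omega> f v = of_real (e / d) * pairing \<Omega> f u" for f
      by (simp add: v_def pairing_eq[OF \<Omega>] mult_ac)
    have "?D v e"
      unfolding dual_bound_def
    proof
      fix f assume "f \<in> bergman \<Omega> r"
      then have "norm (pairing \<Omega> f u) \<le> d * ?M f"
        using u(3) by (simp add: dual_bound_def)
      then have "e / d * norm (pairing \<Omega> f u) \<le> e / d * (d * ?M f)"
        using e u(2) by (intro mult_left_mono) auto
      then show "norm (pairing \<Omega> f v) \<le> e * ?M f"
        using e u(2) by (simp add: pv norm_mult norm_divide)
    qed
    moreover have vK: "2 * (K + ?N g) < ?N v"
    proof -
      have "e / d * (C * d) < e / d * ?N u"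
        using e u by (intro mult_strict_left_mono) auto
      moreover have "e / d * (C * d) = 2 * (K + ?N g) + 1"
        using e u(2) by (simp add: C_def)
      ultimately show ?thesis by (simp add: nv)
    qed
    define h where "h = (\<lambda>z. g z + v z)"
    have h: "h \<in> ?A" unfolding h_def by (rule bergman_add[OF \<Omega> s0(1) g v])
    have hg: "(\<lambda>z. h z - g z) = v" by (simp add: h_def)
    have "?N v \<le> 2 * (?N h + ?N g)"
      using L_norm_diff_le[OF s0(2) L[OF h] L[OF g]] by (simp add: hg)
    from order.strict_trans2[OF vK this] have "K < ?N h" by simp
    ultimately show ?thesis using h hg by auto
  qed
  have lsc: "\<exists>d>0. \<forall>g\<in>?A. ?D (\<lambda>z. g z - h z) d \<longrightarrow> K < ?N g"
    if h: "h \<in> ?A" and K: "0 \<le> K" "K < ?N h" for h K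
  proof (rule ccontr)
    assume neg: "\<not> ?thesis"
    have "\<exists>g. g \<in> ?A \<and> ?D (\<lambda>z. g z - h z) (1 / real (Suc n)) \<and> ?N g \<le> K" for n
      using neg by (auto simp: not_less dest!: spec[of _ "1 / real (Suc n)"])
    then obtain g where g: "\<And>n. g n \<in> ?A" "\<And>n. ?D (\<lambda>z. g n z - h z) (1 / real (Suc n))"
      "\<And>n. ?N (g n) \<le> K" by metis
    have "(\<lambda>n. g n z) \<longlonglongrightarrow> h z" if z: "z \<in> \<Omega>" for z
    proof -
      obtain k where k: "k \<in> bergman \<Omega> r" "\<And>u. u \<in> ?A \<Longrightarrow> u z = pairing \<Omega> u k"
        using kernel[OF z] by blast
      have "norm (g n z - h z) \<le> 1 / real (Suc n) * ?M k" for n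
      proof -
        have "g n z - h z = pairing \<Omega> (\<lambda>z. g n z - h z) k"
          using k(2)[OF diffA[OF g(1) h]] .
        then have "norm (g n z - h z) = norm (pairing \<Omega> k (\<lambda>z. g n z - h z))"
          using pairing_swap[OF \<Omega>, of k "\<lambda>z. g n z - h z"] by simp
        also have "\<dots> \<le> 1 / real (Suc n) * ?M k"
          using g(2)[of n] k(1) unfolding dual_bound_def by blast
        finally show ?thesis .
      qed
      moreover have "(\<lambda>n. 1 / real (Suc n) * ?M k) \<longlonglongrightarrow> 0"
        using tendsto_mult_left[OF LIMSEQ_inverse_real_of_nat, of "?M k"]
        by (simp add: inverse_eq_divide)
      ultimately have "(\<lambda>n. g n z - h z) \<longlonglongrightarrow> 0"
        by (rule Lim_null_comparison[OF always_eventually, OF allI])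
      then show ?thesis by (simp add: LIM_zero_iff)
    qed
    then have "?N h \<le> K"
      by (intro L_norm_Fatou(2)[OF s0(1) L[OF g(1)] K(1) g(3)]) (simp add: space_restrict_space)
    then show False using K by simp
  qed
  \<comment> \<open>Balls are recorded by centre and radius. Radii are halved at each step, so the tail of the
    sequence of centres moves by at most twice the current radius; hence the factor 2 in \<open>P\<close>.\<close>
  define P where "P = (\<lambda>n (h, e). h \<in> ?A \<and> 0 < e \<and> (\<forall>g\<in>?A. ?D (\<lambda>z. g z - h z) (2 * e) \<longrightarrow> real n < ?N g))"
  define Q where "Q = (\<lambda>(h, e) (h', e'). ?D (\<lambda>z. h' z - h z) e \<and> e' \<le> e / (2::real))"
  have step: "\<exists>y. P n y \<and> Q x y" if x: "fst x \<in> ?A" "0 < snd x" for n and x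
  proof -
    obtain h where h: "h \<in> ?A" "?D (\<lambda>z. h z - fst x z) (snd x)" "real n < ?N h"
      using big[OF x, of "real n"] by auto
    obtain d where d: "0 < d" "\<And>g. g \<in> ?A \<Longrightarrow> ?D (\<lambda>z. g z - h z) d \<Longrightarrow> real n < ?N g"
      using lsc[OF h(1) _ h(3)] by auto
    have mono: "?D u d" if "?D u (2 * min (d / 2) (snd x / 2))" for u
      unfolding dual_bound_def
    proof
      fix f assume "f \<in> bergman \<Omega> r"
      then have "norm (pairing \<Omega> f u) \<le> 2 * min (d / 2) (snd x / 2) * ?M f"
        using that unfolding dual_bound_def by blast
      also have "\<dots> \<le> d * ?M f" by (intro mult_right_mono) auto
      finally show "norm (pairing \<Omega> f u) \<le> d * ?M f" .
    qed
    show ?thesis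
      using h d mono x unfolding P_def Q_def
      by (intro exI[of _ "(h, min (d / 2) (snd x / 2))"]) (auto simp: case_prod_beta)
  qed
  have "(\<lambda>z. 0) \<in> ?A"
    using bergman_cmult[OF \<Omega>, of _ s 0] neg[of 1] by auto
  then have "\<exists>x. P 0 x"
    using step[of "(\<lambda>z. 0, 1)" 0] by auto
  moreover have "\<exists>y. P (Suc n) y \<and> Q x y" if "P n x" for x n
    using that by (intro step) (auto simp: P_def)
  ultimately obtain X where X: "\<And>n. P n (X n)" "\<And>n. Q (X n) (X (Suc n))"
    using dependent_nat_choice[of P "\<lambda>_. Q"] by metis
  define h e where "h = (\<lambda>n. fst (X n))" and "e = (\<lambda>n. snd (X n))"
  have h: "h n \<in> ?A" and e: "0 < e n"
    and close: "\<And>g. g \<in> ?A \<Longrightarrow> ?D (\<lambda>z. g z - h n z) (2 * e n) \<Longrightarrow> real n < ?N g" for n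
    using X(1)[of n] by (auto simp: P_def h_def e_def case_prod_beta)
  have near: "?D (\<lambda>z. h (Suc n) z - h n z) (e n)" and half: "e (Suc n) \<le> e n / 2" for n
    using X(2)[of n] by (auto simp: Q_def h_def e_def case_prod_beta)
  have tail: "norm (pairing \<Omega> f (h (n + k)) - pairing \<Omega> f (h n)) \<le> 2 * (e n - e (n + k)) * ?M f"
    if f: "f \<in> bergman \<Omega> r" for f n k
  proof (induction k)
    case (Suc k)
    have "pairing \<Omega> f (h (Suc (n + k))) - pairing \<Omega> f (h (n + k))
        = pairing \<Omega> f (\<lambda>z. h (Suc (n + k)) z - h (n + k) z)"
      by (rule pairing_diff_right[OF \<Omega> rs Lr[OF f] L L, symmetric]) (rule h)+
    then have "norm (pairing \<Omega> f (h (Suc (n + k))) - pairing \<Omega> f (h (n + k))) \<le> e (n + k) * ?M f"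
      using near[of "n + k"] f unfolding dual_bound_def by simp
    also have "\<dots> \<le> 2 * (e (n + k) - e (Suc (n + k))) * ?M f"
      using half[of "n + k"] by (intro mult_right_mono) auto
    finally show ?case
      using Suc norm_triangle_ineq[of "pairing \<Omega> f (h (Suc (n + k))) - pairing \<Omega> f (h (n + k))"
          "pairing \<Omega> f (h (n + k)) - pairing \<Omega> f (h n)"]
      by (simp add: algebra_simps)
  qed simp
  have tail': "norm (pairing \<Omega> f (h m) - pairing \<Omega> f (h n)) \<le> 2 * e n * ?M f"
    if f: "f \<in> bergman \<Omega> r" and "n \<le> m" for f n m
  proof -
    have "norm (pairing \<Omega> f (h m) - pairing \<Omega> f (h n)) \<le> 2 * (e n - e m) * ?M f"
      using tail[OF f, of n "m - n"] that by simp
    also have "\<dots> \<le> 2 * e n * ?M f"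
      using e[of m] by (intro mult_right_mono) auto
    finally show ?thesis .
  qed
  have e0: "e \<longlonglongrightarrow> 0"
  proof (rule Lim_null_comparison)
    have "e n \<le> e 0 * (1 / 2) ^ n" for n
    proof (induction n)
      case (Suc n)
      then show ?case using half[of n] by simp
    qed simp
    then show "\<forall>\<^sub>F n in sequentially. norm (e n) \<le> e 0 * (1 / 2) ^ n"
      using e by (auto simp: abs_of_pos)
    show "(\<lambda>n. e 0 * (1 / 2) ^ n) \<longlonglongrightarrow> 0"
      by (intro tendsto_mult_right_zero LIMSEQ_power_zero) auto
  qed
  \<comment> \<open>The limit is taken in the dual space, value by value; it is represented only afterwards.\<close>
  define Lf where "Lf = (\<lambda>f. lim (\<lambda>n. pairing \<Omega> f (h n)))"
  have conv: "(\<lambda>n. pairing \<Omega> f (h n)) \<longlonglongrightarrow> Lf f" if f: "f \<in> bergman \<Omega> r" for f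
  proof -
    have "Cauchy (\<lambda>n. pairing \<Omega> f (h n))"
    proof (rule metric_CauchyI)
      fix \<epsilon> :: real assume "0 < \<epsilon>"
      have "(\<lambda>n. 2 * e n * ?M f) \<longlonglongrightarrow> 2 * 0 * ?M f"
        by (intro tendsto_intros e0)
      then have "\<forall>\<^sub>F n in sequentially. 2 * e n * ?M f < \<epsilon> / 2"
        using \<open>0 < \<epsilon>\<close> by (intro order_tendstoD(2)[of _ "2 * 0 * ?M f"]) auto
      then obtain n where n: "2 * e n * ?M f < \<epsilon> / 2"
        by (auto simp: eventually_sequentially)
      show "\<exists>M. \<forall>m\<ge>M. \<forall>n\<ge>M. dist (pairing \<Omega> f (h m)) (pairing \<Omega> f (h n)) < \<epsilon>"
      proof (intro exI[of _ n] allI impI)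
        fix m k assume mk: "n \<le> m" "n \<le> k"
        have "dist (pairing \<Omega> f (h m)) (pairing \<Omega> f (h n)) < \<epsilon> / 2"
          "dist (pairing \<Omega> f (h k)) (pairing \<Omega> f (h n)) < \<epsilon> / 2"
          using tail'[OF f mk(1)] tail'[OF f mk(2)] n by (auto simp: dist_norm)
        then show "dist (pairing \<Omega> f (h m)) (pairing \<Omega> f (h k)) < \<epsilon>"
          by (rule dist_triangle_half_l)
      qed
    qed
    then show ?thesis
      unfolding Lf_def by (simp add: Cauchy_convergent_iff convergent_LIMSEQ_iff)
  qed
  have dist: "norm (Lf f - pairing \<Omega> f (h n)) \<le> 2 * e n * ?M f" if f: "f \<in> bergman \<Omega> r" for f n
    by (rule LIMSEQ_le_const2[OF tendsto_norm[OF tendsto_diff[OF conv[OF f] tendsto_const]]])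
       (use tail'[OF f] in blast)
  have "\<exists>g\<in>?A. \<forall>f\<in>bergman \<Omega> r. Lf f = pairing \<Omega> f g"
  proof (rule Phi_surjectiveD[OF surj \<Omega> s0(3)])
    fix f f' assume f: "f \<in> bergman \<Omega> r" "f' \<in> bergman \<Omega> r"
    have "(\<lambda>n. pairing \<Omega> (\<lambda>z. f z + f' z) (h n)) \<longlonglongrightarrow> Lf f + Lf f'"
      using tendsto_add[OF conv[OF f(1)] conv[OF f(2)]]
        pairing_add_left[OF \<Omega> rs Lr[OF f(1)] Lr[OF f(2)] L[OF h]] by simp
    then show "Lf (\<lambda>z. f z + f' z) = Lf f + Lf f'"
      using conv[OF bergman_add[OF \<Omega> s0(3) f]] LIMSEQ_unique by blast
  next
    fix c f assume f: "f \<in> bergman \<Omega> r"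
    have "(\<lambda>n. pairing \<Omega> (\<lambda>z. c * f z) (h n)) \<longlonglongrightarrow> c * Lf f"
      using tendsto_mult_left[OF conv[OF f], of c] by (simp add: pairing_cmult_left[OF \<Omega>])
    then show "Lf (\<lambda>z. c * f z) = c * Lf f"
      using conv[OF bergman_cmult[OF \<Omega> f]] LIMSEQ_unique by blast
  next
    fix f assume f: "f \<in> bergman \<Omega> r"
    have "norm (pairing \<Omega> f (h 0)) \<le> ?M f * ?N (h 0)"
      by (rule norm_pairing_le[OF \<Omega> rs Lr[OF f] L[OF h]])
    then show "norm (Lf f) \<le> (2 * e 0 + ?N (h 0)) * ?M f"
      using dist[OF f, of 0] norm_triangle_sub[of "Lf f" "pairing \<Omega> f (h 0)"]
      by (simp add: algebra_simps)
  qed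
  then obtain g where g: "g \<in> ?A" "\<And>f. f \<in> bergman \<Omega> r \<Longrightarrow> Lf f = pairing \<Omega> f g"
    by blast
  have "real n < ?N g" for n
  proof (rule close[OF g(1)])
    show "?D (\<lambda>z. g z - h n z) (2 * e n)"
      unfolding dual_bound_def
    proof
      fix f assume f: "f \<in> bergman \<Omega> r"
      show "norm (pairing \<Omega> f (\<lambda>z. g z - h n z)) \<le> 2 * e n * ?M f"
        using dist[OF f, of n] g(2)[OF f] pairing_diff_right[OF \<Omega> rs Lr[OF f] L[OF g(1)] L[OF h]]
        by simp
    qed
  qed
  then show False using reals_Archimedean2 not_less_iff_gr_or_eq by blast
qed

section \<open>The Bergman projection\<close>

text \<open>
  For the kernel \<open>\<kappa>\<close> that represents point evaluations this is the Bergman projection. As an explicit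
  integral operator it is the same map for all exponents, so its bounds on \<open>L\<^sup>p\<close> and on \<open>L\<^sup>q\<close> are
  automatically compatible.
\<close>

definition bergman_projection ::
  "(complex ^ 'n) set \<Rightarrow> (complex ^ 'n \<Rightarrow> complex ^ 'n \<Rightarrow> complex) \<Rightarrow> (complex ^ 'n \<Rightarrow> complex) \<Rightarrow> complex ^ 'n \<Rightarrow> complex" where
  "bergman_projection \<Omega> \<kappa> h = (\<lambda>z. if z \<in> \<Omega> then pairing \<Omega> h (\<kappa> z) else 0)"

text \<open>
  Let \<open>g\<close> represent the functional \<open>\<langle>\<cdot>, h\<rangle>\<close> on \<open>A\<^sup>r\<close>. Testing with \<open>\<kappa> z\<close> shows that the projection of
  \<open>h\<close> is \<open>g\<close>, so it lies in \<open>A\<^sup>s\<close>; Hoelder's inequality bounds the functional by the norm of \<open>h\<close>, and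
  the bounded inverse of the duality map transfers this bound to \<open>g\<close>.
\<close>

lemma bergman_projection_bounded:
  fixes \<Omega> :: "(complex ^ 'n) set"
  assumes \<Omega>: "open \<Omega>" and rs: "1 < r" "1 < s" "1 / r + 1 / s = 1"
    and surj: "Phi_surjective \<Omega> r s"
    and \<kappa>: "\<And>z. z \<in> \<Omega> \<Longrightarrow> \<kappa> z \<in> bergman \<Omega> r"
    and repr: "\<And>z g. z \<in> \<Omega> \<Longrightarrow> g \<in> bergman \<Omega> s \<Longrightarrow> g z = pairing \<Omega> g (\<kappa> z)"
  shows "h \<in> L_space (lborel_on \<Omega>) s \<Longrightarrow> bergman_projection \<Omega> \<kappa> h \<in> bergman \<Omega> s"
    and "\<exists>C>0. \<forall>h\<in>L_space (lborel_on \<Omega>) s.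
           L_norm (lborel_on \<Omega>) s (bergman_projection \<Omega> \<kappa> h) \<le> C * L_norm (lborel_on \<Omega>) s h"
proof -
  let ?T = "bergman_projection \<Omega> \<kappa>"
  let ?N = "L_norm (lborel_on \<Omega>) s"
  have Lr: "f \<in> L_space (lborel_on \<Omega>) r" if "f \<in> bergman \<Omega> r" for f
    using that \<Omega> by (simp add: bergman_iff)
  have T: "?T h \<in> bergman \<Omega> s \<and> (\<forall>f\<in>bergman \<Omega> r. pairing \<Omega> f h = pairing \<Omega> f (?T h))"
    if h: "h \<in> L_space (lborel_on \<Omega>) s" for h
  proof -
    have "\<exists>g\<in>bergman \<Omega> s. \<forall>f\<in>bergman \<Omega> r. pairing \<Omega> f h = pairing \<Omega> f g"
    proof (rule Phi_surjectiveD[OF surj \<Omega>])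
      show "norm (pairing \<Omega> f h) \<le> ?N h * L_norm (lborel_on \<Omega>) r f" if "f \<in> bergman \<Omega> r" for f
        using norm_pairing_le[OF \<Omega> rs Lr[OF that] h] by (simp add: mult.commute)
    qed (use rs pairing_add_left[OF \<Omega> rs Lr Lr h] pairing_cmult_left[OF \<Omega>] in auto)
    then obtain g where g: "g \<in> bergman \<Omega> s" "\<And>f. f \<in> bergman \<Omega> r \<Longrightarrow> pairing \<Omega> f h = pairing \<Omega> f g"
      by blast
    have "?T h z = g z" for z
    proof (cases "z \<in> \<Omega>")
      case True
      have "pairing \<Omega> h (\<kappa> z) = cnj (pairing \<Omega> (\<kappa> z) h)"
        by (rule pairing_swap[OF \<Omega>])
      also have "\<dots> = cnj (pairing \<Omega> (\<kappa> z) g)" using g(2)[OF \<kappa>[OF True]] by simp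
      also have "\<dots> = pairing \<Omega> g (\<kappa> z)" by (rule pairing_swap[OF \<Omega>, symmetric])
      also have "\<dots> = g z" using repr[OF True g(1)] by simp
      finally show ?thesis using True by (simp add: bergman_projection_def)
    next
      case False
      then show ?thesis using g(1) \<Omega> by (simp add: bergman_projection_def bergman_iff)
    qed
    then have "?T h = g" by auto
    then show ?thesis using g by auto
  qed
  then show "h \<in> L_space (lborel_on \<Omega>) s \<Longrightarrow> ?T h \<in> bergman \<Omega> s" by blast
  obtain C where C: "C > 0" "\<And>g e. g \<in> bergman \<Omega> s \<Longrightarrow> e > 0 \<Longrightarrow> dual_bound \<Omega> r g e \<Longrightarrow> ?N g \<le> C * e"
    using Phi_inverse_bounded[OF \<Omega> rs surj] \<kappa> repr by metis
  show "\<exists>C>0. \<forall>h\<in>L_space (lborel_on \<Omega>) s. ?N (?T h) \<le> C * ?N h"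
  proof (intro exI[of _ C] conjI ballI C(1))
    fix h assume h: "h \<in> L_space (lborel_on \<Omega>) s"
    show "?N (?T h) \<le> C * ?N h"
    proof (rule field_le_epsilon)
      fix \<delta> :: real assume \<delta>: "0 < \<delta>"
      \<comment> \<open>The bound on the inverse is stated for positive \<open>e\<close>, while the norm of \<open>h\<close> may vanish.\<close>
      define e where "e = ?N h + \<delta> / C"
      have e: "0 < e" using \<delta> C(1) by (simp add: e_def add_nonneg_pos)
      have "dual_bound \<Omega> r (?T h) e"
        unfolding dual_bound_def
      proof
        fix f assume f: "f \<in> bergman \<Omega> r"
        have "norm (pairing \<Omega> f (?T h)) = norm (pairing \<Omega> f h)" using T[OF h] f by simp
        also have "\<dots> \<le> L_norm (lborel_on \<Omega>) r f * ?N h"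
          by (rule norm_pairing_le[OF \<Omega> rs Lr[OF f] h])
        also have "\<dots> \<le> L_norm (lborel_on \<Omega>) r f * e"
          using \<delta> C(1) by (intro mult_left_mono) (auto simp: e_def)
        finally show "norm (pairing \<Omega> f (?T h)) \<le> e * L_norm (lborel_on \<Omega>) r f"
          by (simp add: mult.commute)
      qed
      then have "?N (?T h) \<le> C * e" using C(2) T[OF h] e by blast
      then show "?N (?T h) \<le> C * ?N h + \<delta>" using C(1) by (simp add: e_def ring_distribs)
    qed
  qed
qed

lemma bergman_projection_diff:
  fixes \<Omega> :: "(complex ^ 'n) set"
  assumes \<Omega>: "open \<Omega>" and rs: "1 < r" "1 < s" "1 / r + 1 / s = 1"
    and \<kappa>: "\<And>z. z \<in> \<Omega> \<Longrightarrow> \<kappa> z \<in> bergman \<Omega> s"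
    and hk: "h \<in> L_space (lborel_on \<Omega>) r" "k \<in> L_space (lborel_on \<Omega>) r"
  shows "bergman_projection \<Omega> \<kappa> (\<lambda>x. h x - k x) = (\<lambda>z. bergman_projection \<Omega> \<kappa> h z - bergman_projection \<Omega> \<kappa> k z)"
proof
  fix z
  show "bergman_projection \<Omega> \<kappa> (\<lambda>x. h x - k x) z = bergman_projection \<Omega> \<kappa> h z - bergman_projection \<Omega> \<kappa> k z"
  proof (cases "z \<in> \<Omega>")
    case True
    then have "\<kappa> z \<in> L_space (lborel_on \<Omega>) s" using \<kappa> \<Omega> by (simp add: bergman_iff)
    from pairing_add_left[OF \<Omega> rs hk(1) L_space_cmult[OF hk(2), of "-1"] this]
    show ?thesis
      using True pairing_cmult_left[OF \<Omega>, of "-1" k "\<kappa> z"] by (simp add: bergman_projection_def)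
  qed (simp add: bergman_projection_def)
qed

lemma bergman_projection_cmult:
  assumes "open \<Omega>"
  shows "bergman_projection \<Omega> \<kappa> (\<lambda>x. a * h x) = (\<lambda>z. a * bergman_projection \<Omega> \<kappa> h z)"
  using pairing_cmult_left[OF assms] by (auto simp: bergman_projection_def)

section \<open>Analytic families of powers\<close>

text \<open>
  The family \<open>\<sigma> u ^ ((1 - z) a + z b)\<close>, which interpolates between \<open>\<sigma> u ^ a\<close> and \<open>\<sigma> u ^ b\<close>. The case
  distinction is essential: as \<open>ln 0 = 0\<close>, the formula alone would give \<open>\<sigma>\<close> where \<open>u\<close> vanishes.
\<close>

definition power_family ::
  "('a \<Rightarrow> complex) \<Rightarrow> ('a \<Rightarrow> real) \<Rightarrow> real \<Rightarrow> real \<Rightarrow> complex \<Rightarrow> 'a \<Rightarrow> complex" where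
  "power_family \<sigma> u a b z x =
     (if u x = 0 then 0 else \<sigma> x * exp (((1 - z) * of_real a + z * of_real b) * of_real (ln (u x))))"

lemma L_norm_dominated_tendsto:
  assumes r: "0 < r" and meas: "\<And>w. w \<in> S \<Longrightarrow> w \<noteq> z \<Longrightarrow> f w \<in> borel_measurable M"
    and dom: "integrable M d" "\<And>w x. w \<in> S \<Longrightarrow> w \<noteq> z \<Longrightarrow> x \<in> space M \<Longrightarrow> norm (f w x) powr r \<le> d x"
    and lim: "\<And>x. x \<in> space M \<Longrightarrow> ((\<lambda>w. f w x) \<longlongrightarrow> 0) (at z within S)"
  shows "((\<lambda>w::complex. L_norm M r (f w)) \<longlongrightarrow> 0) (at z within S)"
  unfolding tendsto_at_iff_sequentially
proof (intro allI impI)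
  fix X assume X: "\<forall>i. X i \<in> S - {z}" "X \<longlonglongrightarrow> z"
  have lim': "(\<lambda>n. norm (f (X n) x) powr r) \<longlonglongrightarrow> 0" if "x \<in> space M" for x
  proof -
    have "(\<lambda>n. f (X n) x) \<longlonglongrightarrow> 0"
      using lim[OF that] X unfolding tendsto_at_iff_sequentially comp_def by blast
    then show ?thesis
      using tendsto_powr'[OF tendsto_norm_zero tendsto_const, of "\<lambda>n. f (X n) x" sequentially r] r by simp
  qed
  have "(\<lambda>n. \<integral>x. norm (f (X n) x) powr r \<partial>M) \<longlonglongrightarrow> (\<integral>x. 0 \<partial>M)"
  proof (rule integral_dominated_convergence[where w = d])
    fix n
    have [measurable]: "f (X n) \<in> borel_measurable M"
      using meas X(1) by blast
    show "(\<lambda>x. norm (f (X n) x) powr r) \<in> borel_measurable M" by measurable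
  qed (use dom X(1) lim' in auto)
  then have "(\<lambda>n. L_norm M r (f (X n))) \<longlonglongrightarrow> 0"
    unfolding L_norm_def
    using r tendsto_powr'[OF _ tendsto_const, of "\<lambda>n. \<integral>x. norm (f (X n) x) powr r \<partial>M" 0 sequentially "1 / r"]
    by simp
  then show "((\<lambda>w. L_norm M r (f w)) \<circ> X) \<longlonglongrightarrow> 0" by (simp add: comp_def)
qed

lemma exp_convex_combination_le:
  fixes A B t :: real
  assumes "0 \<le> t" "t \<le> 1"
  shows "exp ((1 - t) * A + t * B) \<le> exp A + exp B"
proof -
  have "(1 - t) * A + t * B \<le> (1 - t) * max A B + t * max A B"
    using assms by (intro add_mono mult_left_mono) auto
  also have "\<dots> = max A B" by (simp add: algebra_simps)
  finally have "exp ((1 - t) * A + t * B) \<le> exp (max A B)" by simp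
  also have "\<dots> \<le> exp A + exp B" by (simp add: max_def)
  finally show ?thesis .
qed

text \<open>
  With \<open>A = a ln u\<close> and \<open>B = b ln u\<close> this bounds the derivative of the family away from the boundary of
  the strip: the logarithm is absorbed by shifting the parameter by \<open>\<delta>\<close> towards the larger of \<open>A\<close> and \<open>B\<close>,
  since \<open>y \<le> e\<^sup>y\<close>.
\<close>

lemma abs_mult_exp_convex_combination_le:
  fixes A B t \<delta> :: real
  assumes "0 < \<delta>" "\<delta> \<le> t" "t \<le> 1 - \<delta>"
  shows "\<bar>B - A\<bar> * exp ((1 - t) * A + t * B) \<le> (exp A + exp B) / \<delta>"
proof -
  define y where "y = \<delta> * \<bar>B - A\<bar>"
  define t' where "t' = (if A \<le> B then t + \<delta> else t - \<delta>)"
  have "y * exp ((1 - t) * A + t * B) \<le> exp y * exp ((1 - t) * A + t * B)"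
    by (rule mult_right_mono[OF order_trans[OF _ exp_ge_add_one_self]]) auto
  also have "\<dots> = exp ((1 - t') * A + t' * B)"
    by (auto simp: y_def t'_def algebra_simps simp flip: exp_add)
  also have "\<dots> \<le> exp A + exp B"
    using assms by (intro exp_convex_combination_le) (auto simp: t'_def)
  finally show ?thesis using assms(1) by (simp add: y_def field_simps)
qed

lemma norm_power_family:
  "0 \<le> u x \<Longrightarrow> norm (power_family \<sigma> u a b z x) = norm (\<sigma> x) * u x powr ((1 - Re z) * a + Re z * b)"
  by (simp add: power_family_def powr_def norm_mult)

lemma norm_power_family_le:
  assumes "0 \<le> u x" "norm (\<sigma> x) \<le> 1" "z \<in> closed_strip"
  shows "norm (power_family \<sigma> u a b z x) \<le> u x powr a + u x powr b"
proof (cases "u x = 0")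
  case False
  then have u: "0 < u x" using assms by simp
  have "norm (power_family \<sigma> u a b z x) \<le> 1 * u x powr ((1 - Re z) * a + Re z * b)"
    unfolding norm_power_family[of u x, OF assms(1)] using assms by (intro mult_right_mono) auto
  also have "\<dots> = exp ((1 - Re z) * (a * ln (u x)) + Re z * (b * ln (u x)))"
    using u by (simp add: powr_def algebra_simps)
  also have "\<dots> \<le> u x powr a + u x powr b"
    using exp_convex_combination_le[of "Re z" "a * ln (u x)" "b * ln (u x)"] assms u
    by (simp add: powr_def closed_strip_def)
  finally show ?thesis .
qed (simp add: power_family_def)

lemma has_field_derivative_power_family:
  "((\<lambda>z. power_family \<sigma> u a b z x) has_field_derivative
     of_real ((b - a) * ln (u x)) * power_family \<sigma> u a b z x) (at z within S)"
  unfolding power_family_def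
  by (cases "u x = 0") (auto intro!: derivative_eq_intros simp: algebra_simps)

lemma norm_power_family_deriv_le:
  assumes u: "0 \<le> u x" "norm (\<sigma> x) \<le> 1" and \<delta>: "0 < \<delta>" "\<delta> \<le> Re z" "Re z \<le> 1 - \<delta>"
  shows "norm (of_real ((b - a) * ln (u x)) * power_family \<sigma> u a b z x) \<le> (u x powr a + u x powr b) / \<delta>"
proof (cases "u x = 0")
  case False
  then have u': "0 < u x" using assms by simp
  have "norm (of_real ((b - a) * ln (u x)) * power_family \<sigma> u a b z x)
      = norm (\<sigma> x) * (\<bar>b * ln (u x) - a * ln (u x)\<bar> * exp ((1 - Re z) * (a * ln (u x)) + Re z * (b * ln (u x))))"
    using u' unfolding norm_mult norm_of_real norm_power_family[of u x, OF u(1)] left_diff_distrib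
    by (simp add: powr_def algebra_simps)
  also have "\<dots> \<le> 1 * ((exp (a * ln (u x)) + exp (b * ln (u x))) / \<delta>)"
    using u(2) \<delta> by (intro mult_mono abs_mult_exp_convex_combination_le) auto
  finally show ?thesis using u' by (simp add: powr_def)
qed (use \<delta> in \<open>simp add: power_family_def\<close>)

lemma power_family_measurable:
  assumes [measurable]: "\<sigma> \<in> borel_measurable M" "u \<in> borel_measurable M"
  shows "power_family \<sigma> u a b z \<in> borel_measurable M"
  unfolding power_family_def by measurable

text \<open>
  Dominated convergence. On the closed strip \<open>u ^ a + u ^ b\<close> dominates the family; at distance at least
  \<open>\<delta>\<close> from the boundary lines, \<open>(u ^ a + u ^ b) / \<delta>\<close> dominates the derivative and hence, by the
  mean value inequality, the difference quotients.
\<close>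

lemma power_family_L_space:
  fixes \<sigma> :: "'a \<Rightarrow> complex" and u :: "'a \<Rightarrow> real"
  assumes r: "0 < r" and meas: "\<sigma> \<in> borel_measurable M" "u \<in> borel_measurable M"
    and \<sigma>: "\<And>x. x \<in> space M \<Longrightarrow> norm (\<sigma> x) \<le> 1" and u: "\<And>x. x \<in> space M \<Longrightarrow> 0 \<le> u x"
    and int: "integrable M (\<lambda>x. u x powr (a * r))" "integrable M (\<lambda>x. u x powr (b * r))"
  defines "G \<equiv> power_family \<sigma> u a b"
  shows power_family_in_L_space: "\<And>z. z \<in> closed_strip \<Longrightarrow> G z \<in> L_space M r"
    and power_family_L_norm_bounded: "\<exists>B. \<forall>z\<in>closed_strip. L_norm M r (G z) \<le> B"
    and power_family_L_norm_continuous: "\<And>z. z \<in> closed_strip \<Longrightarrow>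
      ((\<lambda>w. L_norm M r (\<lambda>x. G w x - G z x)) \<longlongrightarrow> 0) (at z within closed_strip)"
    and power_family_L_norm_differentiable: "\<And>z. z \<in> open_strip \<Longrightarrow> \<exists>D\<in>L_space M r.
      ((\<lambda>w. L_norm M r (\<lambda>x. (G w x - G z x) / (w - z) - D x)) \<longlongrightarrow> 0) (at z within open_strip)"
proof -
  define d where "d = (\<lambda>x. 2 powr r * (u x powr (a * r) + u x powr (b * r)))"
  have d: "integrable M (\<lambda>x. c powr r * d x)" for c
    using int by (simp add: d_def)
  have dom: "norm y powr r \<le> c powr r * d x"
    if "x \<in> space M" "0 \<le> c" "norm y \<le> c * (u x powr a + u x powr b)" for c x and y :: complex
  proof -
    have "norm y powr r \<le> (c * (u x powr a + u x powr b)) powr r"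
      using that r by (intro powr_mono2) auto
    also have "\<dots> = c powr r * (norm (complex_of_real (u x powr a) + complex_of_real (u x powr b)) powr r)"
      using that by (simp add: powr_mult flip: of_real_add)
    also have "\<dots> \<le> c powr r * d x"
      using norm_add_powr_le[OF r, of "complex_of_real (u x powr a)" "complex_of_real (u x powr b)"]
      by (intro mult_left_mono) (auto simp: d_def powr_powr)
    finally show ?thesis .
  qed
  have G[measurable]: "G z \<in> borel_measurable M" for z
    unfolding G_def by (rule power_family_measurable[OF meas])
  have Gle: "norm (G z x) \<le> 1 * (u x powr a + u x powr b)" if "z \<in> closed_strip" "x \<in> space M" for z x
    using norm_power_family_le[of u x \<sigma> z a b] that u \<sigma> by (simp add: G_def)
  note dom1 = dom[OF _ _ Gle, OF _ zero_le_one]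
  show "G z \<in> L_space M r" if "z \<in> closed_strip" for z
    by (rule L_space_mono[OF G d[of 1]]) (use that dom1 in auto)
  show "\<exists>B. \<forall>z\<in>closed_strip. L_norm M r (G z) \<le> B"
  proof (intro exI ballI)
    fix z assume z: "z \<in> closed_strip"
    show "L_norm M r (G z) \<le> (\<integral>x. 1 powr r * d x \<partial>M) powr (1 / r)"
      unfolding L_norm_def
      using r by (intro powr_mono2 integral_mono' d dom1) (auto simp: d_def intro!: z)
  qed
  show "((\<lambda>w. L_norm M r (\<lambda>x. G w x - G z x)) \<longlongrightarrow> 0) (at z within closed_strip)"
    if z: "z \<in> closed_strip" for z
  proof (rule L_norm_dominated_tendsto[OF r _ d[of 2]])
    fix w x assume "w \<in> closed_strip" "x \<in> space M"
    then have "norm (G w x - G z x) \<le> 2 * (u x powr a + u x powr b)"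
      using Gle[of w x] Gle[OF z, of x] norm_triangle_ineq4[of "G w x" "G z x"] by simp
    then show "norm (G w x - G z x) powr r \<le> 2 powr r * d x"
      using \<open>x \<in> space M\<close> by (intro dom) auto
  next
    fix x
    show "((\<lambda>w. G w x - G z x) \<longlongrightarrow> 0) (at z within closed_strip)"
      using DERIV_continuous[OF has_field_derivative_power_family[of \<sigma> u a b x z closed_strip]]
      by (simp add: continuous_within G_def LIM_zero)
  qed measurable
  show "\<exists>D\<in>L_space M r. ((\<lambda>w. L_norm M r (\<lambda>x. (G w x - G z x) / (w - z) - D x)) \<longlongrightarrow> 0) (at z within open_strip)"
    if z: "z \<in> open_strip" for z
  proof -
    define \<delta> where "\<delta> = min (Re z) (1 - Re z) / 2"
    have \<delta>: "0 < \<delta>" using z by (auto simp: \<delta>_def open_strip_def)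
    have re: "\<delta> \<le> Re w" "Re w \<le> 1 - \<delta>" if "w \<in> ball z \<delta>" for w
    proof -
      have "\<bar>Re z - Re w\<bar> < \<delta>"
        using that abs_Re_le_cmod[of "z - w"] by (simp add: dist_norm)
      moreover have "2 * \<delta> \<le> Re z" "2 * \<delta> \<le> 1 - Re z" by (auto simp: \<delta>_def)
      ultimately show "\<delta> \<le> Re w" "Re w \<le> 1 - \<delta>" by linarith+
    qed
    define D where "D = (\<lambda>w x. complex_of_real ((b - a) * ln (u x)) * G w x)"
    have [measurable]: "D w \<in> borel_measurable M" for w
      unfolding D_def using meas(2) by measurable
    have Dle: "norm (D w x) \<le> 1 / \<delta> * (u x powr a + u x powr b)" if "w \<in> ball z \<delta>" "x \<in> space M" for w x
      using norm_power_family_deriv_le[of u x \<sigma> \<delta> w b a] u \<sigma> \<delta> re that by (simp add: D_def G_def)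
    have der: "((\<lambda>w. G w x) has_field_derivative D w x) (at w within S)" for w x S
      unfolding G_def D_def by (rule has_field_derivative_power_family)
    have strip: "open open_strip"
      unfolding open_strip_def by (intro open_Collect_conj open_Collect_less continuous_intros)
    have "at z within open_strip = at z within ball z \<delta>"
      using at_within_open[OF z strip] at_within_open[OF _ open_ball, of z z \<delta>] \<delta>
      by (simp only: centre_in_ball)
    moreover have "((\<lambda>w. L_norm M r (\<lambda>x. (G w x - G z x) / (w - z) - D z x)) \<longlongrightarrow> 0) (at z within ball z \<delta>)"
    proof (rule L_norm_dominated_tendsto[OF r _ d[of "2 / \<delta>"]])
      fix w x assume w: "w \<in> ball z \<delta>" "w \<noteq> z" and x: "x \<in> space M"
      have "norm (G w x - G z x) \<le> 1 / \<delta> * (u x powr a + u x powr b) * norm (w - z)"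
        by (rule field_differentiable_bound[OF convex_ball der Dle[OF _ x]]) (use w \<delta> in auto)
      then have "norm ((G w x - G z x) / (w - z)) \<le> 1 / \<delta> * (u x powr a + u x powr b)"
        using w(2) by (simp add: norm_divide divide_le_eq)
      then have "norm ((G w x - G z x) / (w - z) - D z x) \<le> 2 / \<delta> * (u x powr a + u x powr b)"
        using order_trans[OF norm_triangle_ineq4 add_mono[OF _ Dle[of z x]]] x \<delta>
        by (fastforce simp: add_divide_distrib)
      then show "norm ((G w x - G z x) / (w - z) - D z x) powr r \<le> (2 / \<delta>) powr r * d x"
        using x \<delta> by (intro dom) auto
    next
      fix x
      show "((\<lambda>w. (G w x - G z x) / (w - z) - D z x) \<longlongrightarrow> 0) (at z within ball z \<delta>)"
        using der[of x z "ball z \<delta>"] by (simp add: has_field_derivative_iff LIM_zero)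
    qed measurable
    moreover have "D z \<in> L_space M r"
      by (rule L_space_mono[OF _ d[of "1 / \<delta>"]]) (use \<delta> Dle in \<open>auto intro!: dom\<close>)
    ultimately show ?thesis by auto
  qed
qed

text \<open>
  On a line where the real part of the exponent is \<open>1 / r\<close>, the \<open>r\<close>-th power of the family is at
  most \<open>u\<close>.
\<close>

lemma power_family_boundary_L_norm:
  assumes r: "0 < r" and meas: "\<sigma> \<in> borel_measurable M" "u \<in> borel_measurable M"
    and \<sigma>: "\<And>x. x \<in> space M \<Longrightarrow> norm (\<sigma> x) \<le> 1" and u: "\<And>x. x \<in> space M \<Longrightarrow> 0 \<le> u x"
    and int: "integrable M u" "(\<integral>x. u x \<partial>M) \<le> 1"
    and exponent: "((1 - Re z) * a + Re z * b) * r = 1"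
  shows "power_family \<sigma> u a b z \<in> L_space M r" "L_norm M r (power_family \<sigma> u a b z) \<le> 1"
proof -
  have le: "norm (power_family \<sigma> u a b z x) powr r \<le> u x" if x: "x \<in> space M" for x
  proof -
    have "norm (power_family \<sigma> u a b z x) powr r
        \<le> (1 * u x powr ((1 - Re z) * a + Re z * b)) powr r"
      unfolding norm_power_family[of u x, OF u[OF x]]
      using \<sigma>[OF x] r by (intro powr_mono2 mult_right_mono) auto
    then show ?thesis using u[OF x] by (simp add: powr_powr exponent)
  qed
  show "power_family \<sigma> u a b z \<in> L_space M r"
    by (rule L_space_mono[OF power_family_measurable[OF meas] int(1) le])
  have "(\<integral>x. norm (power_family \<sigma> u a b z x) powr r \<partial>M) \<le> (\<integral>x. u x \<partial>M)"
    by (rule integral_mono'[OF int(1) le u])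
  then show "L_norm M r (power_family \<sigma> u a b z) \<le> 1"
    using r int(2) by (simp add: L_norm_le_iff)
qed

section \<open>The three lines theorem\<close>

text \<open>
  Damping by \<open>exp (e (z\<^sup>2 - 1))\<close>, of modulus at most \<open>exp (- e (Im z)\<^sup>2)\<close> on the strip, makes the function small
  on the horizontal sides of a high rectangle, so that the maximum principle applies there; then \<open>e\<close>
  tends to 0.
\<close>

lemma three_lines:
  assumes hol: "H holomorphic_on open_strip" and cont: "continuous_on closed_strip H"
    and K: "\<And>z. z \<in> closed_strip \<Longrightarrow> norm (H z) \<le> K"
    and left: "\<And>t. norm (H (Complex 0 t)) \<le> B" and right: "\<And>t. norm (H (Complex 1 t)) \<le> B"
    and z: "z \<in> closed_strip"
  shows "norm (H z) \<le> B"
proof (rule field_le_epsilon)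
  fix \<eta> :: real assume \<eta>: "0 < \<eta>"
  define B' where "B' = B + \<eta>"
  have B': "0 < B'" "B \<le> B'"
    using \<eta> order_trans[OF norm_ge_zero left[of 0]] by (auto simp: B'_def)
  have K0: "0 \<le> K" using order_trans[OF norm_ge_zero K[OF z]] .
  have damped: "norm (H z * exp (of_real e * (z\<^sup>2 - 1))) \<le> B'" if e: "0 < e" for e :: real
  proof -
    \<comment> \<open>High enough to contain \<open>z\<close> and to satisfy \<open>K exp (- e R\<^sup>2) \<le> B'\<close>.\<close>
    define R where "R = \<bar>Im z\<bar> + 1 + K / (B' * e)"
    have q: "0 \<le> K / (B' * e)" using K0 B' e by simp
    have R: "\<bar>Im z\<bar> \<le> R" "1 \<le> R" using q by (auto simp: R_def)
    have "K = B' * (e * (K / (B' * e)))" using B' e by simp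
    also have "\<dots> \<le> B' * (e * R)"
      using B' e by (intro mult_left_mono) (auto simp: R_def)
    also have "\<dots> \<le> B' * (e * R\<^sup>2)"
      using B' e R(2) by (intro mult_left_mono) (auto simp: power2_eq_square)
    also have "\<dots> \<le> B' * exp (e * R\<^sup>2)"
      using B' by (intro mult_left_mono order_trans[OF _ exp_ge_add_one_self]) auto
    finally have KR: "K * exp (- (e * R\<^sup>2)) \<le> B'"
      by (simp add: exp_minus divide_simps)
    define E where "E = (\<lambda>w. H w * exp (of_real e * (w\<^sup>2 - 1)))"
    have nE: "norm (E w) \<le> norm (H w) * exp (- (e * (Im w)\<^sup>2))" if "w \<in> closed_strip" for w
    proof -
      have "(Re w)\<^sup>2 \<le> 1" using that by (auto simp: closed_strip_def abs_square_le_1)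
      then have "e * ((Re w)\<^sup>2 - (Im w)\<^sup>2 - 1) \<le> - (e * (Im w)\<^sup>2)"
        using e by (simp add: right_diff_distrib)
      then show ?thesis
        by (simp add: E_def norm_mult Re_power2 mult_left_mono)
    qed
    define S where "S = cbox (Complex 0 (- R)) (Complex 1 R)"
    have S: "S = {w. 0 \<le> Re w \<and> Re w \<le> 1 \<and> - R \<le> Im w \<and> Im w \<le> R}"
      by (auto simp: S_def in_cbox_complex_iff)
    have int: "interior S = {w. 0 < Re w \<and> Re w < 1 \<and> - R < Im w \<and> Im w < R}"
      by (auto simp: S_def interior_cbox in_box_complex_iff)
    have "norm (E z) \<le> B'"
    proof (rule maximum_modulus_frontier[of E S])
      show "E holomorphic_on interior S"
        unfolding E_def using hol
        by (intro holomorphic_intros) (auto elim!: holomorphic_on_subset simp: int open_strip_def)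
      have "closure S = S" by (simp add: S_def)
      then show "continuous_on (closure S) E"
        unfolding E_def using cont
        by (intro continuous_intros) (auto elim!: continuous_on_subset simp: S closed_strip_def)
      show "bounded S" by (simp add: S_def)
      show "z \<in> S" using z R by (auto simp: S closed_strip_def)
      fix w assume "w \<in> frontier S"
      then have w: "w \<in> S" "w \<notin> interior S" using \<open>closure S = S\<close> by (auto simp: frontier_def)
      have ws: "w \<in> closed_strip" using w(1) by (auto simp: S closed_strip_def)
      have "Re w = 0 \<or> Re w = 1 \<or> \<bar>Im w\<bar> = R" using w(2) w(1)[unfolded S] unfolding int by auto
      then show "norm (E w) \<le> B'"
      proof (elim disjE)
        assume "\<bar>Im w\<bar> = R"
        then have "(Im w)\<^sup>2 = R\<^sup>2" using power2_abs[of "Im w"] by simp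
        then have "norm (E w) \<le> K * exp (- (e * R\<^sup>2))"
          using order_trans[OF nE[OF ws] mult_right_mono[OF K[OF ws]]] by simp
        then show ?thesis using KR by simp
      next
        assume "Re w = 0"
        then have "norm (H w) \<le> B" using left[of "Im w"] by (metis complex.collapse)
        moreover have "norm (E w) \<le> norm (H w) * 1"
          using e by (intro order_trans[OF nE[OF ws]] mult_left_mono) auto
        ultimately show ?thesis using B' by simp
      next
        assume "Re w = 1"
        then have "norm (H w) \<le> B" using right[of "Im w"] by (metis complex.collapse)
        moreover have "norm (E w) \<le> norm (H w) * 1"
          using e by (intro order_trans[OF nE[OF ws]] mult_left_mono) auto
        ultimately show ?thesis using B' by simp
      qed
    qed
    then show ?thesis by (simp add: E_def)
  qed
  have "((\<lambda>e. norm (H z * exp (of_real e * (z\<^sup>2 - 1)))) \<longlongrightarrow> norm (H z * exp (of_real 0 * (z\<^sup>2 - 1)))) (at_right 0)"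
    by (intro tendsto_intros)
  then have "norm (H z * exp (of_real 0 * (z\<^sup>2 - 1))) \<le> B'"
    by (rule tendsto_upperbound) (auto simp: eventually_at_right_less damped intro: eventually_mono[OF eventually_at_right_less])
  then show "norm (H z) \<le> B + \<eta>" by (simp add: B'_def)
qed

text \<open>
  The integral of \<open>F z \<cdot> G z\<close> is bounded, continuous and holomorphic in \<open>z\<close> by the product rule, whose terms
  are estimated by Hoelder's inequality.
\<close>

lemma three_lines_pairing:
  assumes rs: "1 < r" "1 < s" "1 / r + 1 / s = 1"
    and F: "\<And>z. z \<in> closed_strip \<Longrightarrow> F z \<in> L_space M r"
    and Fb: "\<And>z. z \<in> closed_strip \<Longrightarrow> L_norm M r (F z) \<le> Bf"
    and Fc: "\<And>z. z \<in> closed_strip \<Longrightarrow> ((\<lambda>w. L_norm M r (\<lambda>x. F w x - F z x)) \<longlongrightarrow> 0) (at z within closed_strip)"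
    and Fd: "\<And>z. z \<in> open_strip \<Longrightarrow> \<exists>D\<in>L_space M r.
      ((\<lambda>w. L_norm M r (\<lambda>x. (F w x - F z x) / (w - z) - D x)) \<longlongrightarrow> 0) (at z within open_strip)"
    and G: "\<And>z. z \<in> closed_strip \<Longrightarrow> G z \<in> L_space M s"
    and Gb: "\<And>z. z \<in> closed_strip \<Longrightarrow> L_norm M s (G z) \<le> Bg"
    and Gc: "\<And>z. z \<in> closed_strip \<Longrightarrow> ((\<lambda>w. L_norm M s (\<lambda>x. G w x - G z x)) \<longlongrightarrow> 0) (at z within closed_strip)"
    and Gd: "\<And>z. z \<in> open_strip \<Longrightarrow> \<exists>D\<in>L_space M s.
      ((\<lambda>w. L_norm M s (\<lambda>x. (G w x - G z x) / (w - z) - D x)) \<longlongrightarrow> 0) (at z within open_strip)"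
    and left: "\<And>t. norm (\<integral>x. F (Complex 0 t) x * G (Complex 0 t) x \<partial>M) \<le> B"
    and right: "\<And>t. norm (\<integral>x. F (Complex 1 t) x * G (Complex 1 t) x \<partial>M) \<le> B"
    and z: "z \<in> closed_strip"
  shows "norm (\<integral>x. F z x * G z x \<partial>M) \<le> B"
proof -
  define I where "I = (\<lambda>f g. \<integral>x. f x * g x \<partial>M :: complex)"
  define H where "H = (\<lambda>z. I (F z) (G z))"
  have pos: "0 < r" "0 < s" using rs by auto
  have Bg0: "0 \<le> Bg" using order_trans[OF L_norm_nonneg Gb[OF z]] .
  have int: "integrable M (\<lambda>x. f x * g x)" if "f \<in> L_space M r" "g \<in> L_space M s" for f g
    by (rule Holder_integrable[OF rs that])
  have Ile: "norm (I f g) \<le> L_norm M r f * L_norm M s g" if "f \<in> L_space M r" "g \<in> L_space M s" for f g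
    unfolding I_def by (rule Holder_norm_le[OF rs that])
  have Idl: "I (\<lambda>x. f x - h x) g = I f g - I h g"
    if "f \<in> L_space M r" "h \<in> L_space M r" "g \<in> L_space M s" for f h g
    using int[OF that(1,3)] int[OF that(2,3)] by (simp add: I_def left_diff_distrib)
  have Idr: "I f (\<lambda>x. g x - h x) = I f g - I f h"
    if "f \<in> L_space M r" "g \<in> L_space M s" "h \<in> L_space M s" for f h g
    using int[OF that(1,2)] int[OF that(1,3)] by (simp add: I_def right_diff_distrib)
  have Icl: "I (\<lambda>x. f x / c) g = I f g / c" and Icr: "I f (\<lambda>x. g x / c) = I f g / c" for f g c
    by (simp_all add: I_def)
  have sub: "open_strip \<subseteq> closed_strip" by (auto simp: open_strip_def closed_strip_def)
  have Ldiv: "(\<lambda>x. f x / c) \<in> L_space M t" if "f \<in> L_space M t" for f c t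
    using L_space_cmult[OF that, of "1 / c"] by simp
  have Hb: "norm (H w) \<le> Bf * Bg" if "w \<in> closed_strip" for w
    unfolding H_def
    by (rule order_trans[OF Ile[OF F[OF that] G[OF that]]])
       (intro mult_mono Fb[OF that] Gb[OF that] order_trans[OF L_norm_nonneg Fb[OF that]] L_norm_nonneg)
  have cont: "continuous_on closed_strip H"
    unfolding continuous_on_def
  proof
    fix z assume z: "z \<in> closed_strip"
    have "((\<lambda>w. H w - H z) \<longlongrightarrow> 0) (at z within closed_strip)"
    proof (rule Lim_null_comparison)
      show "((\<lambda>w. L_norm M r (\<lambda>x. F w x - F z x) * Bg + L_norm M r (F z) * L_norm M s (\<lambda>x. G w x - G z x))
          \<longlongrightarrow> 0) (at z within closed_strip)"
        using tendsto_add[OF tendsto_mult_left_zero[OF Fc[OF z]] tendsto_mult_right_zero[OF Gc[OF z]]] by simp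
      show "\<forall>\<^sub>F w in at z within closed_strip. norm (H w - H z)
          \<le> L_norm M r (\<lambda>x. F w x - F z x) * Bg + L_norm M r (F z) * L_norm M s (\<lambda>x. G w x - G z x)"
        unfolding eventually_at_topological
      proof (intro exI[of _ UNIV] conjI ballI impI)
        fix w assume w: "w \<in> closed_strip"
        note d = L_space_diff[OF pos(1) F[OF w] F[OF z]] L_space_diff[OF pos(2) G[OF w] G[OF z]]
        have "H w - H z = I (\<lambda>x. F w x - F z x) (G w) + I (F z) (\<lambda>x. G w x - G z x)"
          unfolding H_def using F G w z by (simp add: Idl Idr)
        then have "norm (H w - H z) \<le> norm (I (\<lambda>x. F w x - F z x) (G w)) + norm (I (F z) (\<lambda>x. G w x - G z x))"
          by (simp add: norm_triangle_ineq)
        also have "\<dots> \<le> L_norm M r (\<lambda>x. F w x - F z x) * L_norm M s (G w)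
            + L_norm M r (F z) * L_norm M s (\<lambda>x. G w x - G z x)"
          by (intro add_mono Ile d F[OF z] G[OF w])
        also have "\<dots> \<le> L_norm M r (\<lambda>x. F w x - F z x) * Bg + L_norm M r (F z) * L_norm M s (\<lambda>x. G w x - G z x)"
          by (intro add_mono mult_left_mono Gb[OF w] L_norm_nonneg order_refl)
        finally show "norm (H w - H z)
            \<le> L_norm M r (\<lambda>x. F w x - F z x) * Bg + L_norm M r (F z) * L_norm M s (\<lambda>x. G w x - G z x)" .
      qed auto
    qed
    then show "(H \<longlongrightarrow> H z) (at z within closed_strip)" by (simp add: LIM_zero_iff)
  qed
  have hol: "H holomorphic_on open_strip"
    unfolding holomorphic_on_def field_differentiable_def
  proof
    fix z assume zo: "z \<in> open_strip"
    then have z: "z \<in> closed_strip" using sub by auto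
    obtain D where D: "D \<in> L_space M r"
      "((\<lambda>w. L_norm M r (\<lambda>x. (F w x - F z x) / (w - z) - D x)) \<longlongrightarrow> 0) (at z within open_strip)"
      using Fd[OF zo] by blast
    obtain E where E: "E \<in> L_space M s"
      "((\<lambda>w. L_norm M s (\<lambda>x. (G w x - G z x) / (w - z) - E x)) \<longlongrightarrow> 0) (at z within open_strip)"
      using Gd[OF zo] by blast
    have Gc': "((\<lambda>w. L_norm M s (\<lambda>x. G w x - G z x)) \<longlongrightarrow> 0) (at z within open_strip)"
      by (rule tendsto_within_subset[OF Gc[OF z] sub])
    define c where "c = (\<lambda>w. L_norm M r (\<lambda>x. (F w x - F z x) / (w - z) - D x) * Bg
        + L_norm M r D * L_norm M s (\<lambda>x. G w x - G z x)
        + L_norm M r (F z) * L_norm M s (\<lambda>x. (G w x - G z x) / (w - z) - E x))"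
    have "((\<lambda>w. (H w - H z) / (w - z) - (I D (G z) + I (F z) E)) \<longlongrightarrow> 0) (at z within open_strip)"
    proof (rule Lim_null_comparison)
      show "(c \<longlongrightarrow> 0) (at z within open_strip)"
        unfolding c_def
        using tendsto_add[OF tendsto_add[OF tendsto_mult_left_zero[OF D(2)] tendsto_mult_right_zero[OF Gc']]
            tendsto_mult_right_zero[OF E(2)]] by simp
      show "\<forall>\<^sub>F w in at z within open_strip. norm ((H w - H z) / (w - z) - (I D (G z) + I (F z) E)) \<le> c w"
        unfolding eventually_at_topological
      proof (intro exI[of _ UNIV] conjI ballI impI)
        fix w assume "w \<in> open_strip" "w \<noteq> z"
        from this(1) have w: "w \<in> closed_strip" using sub by auto
        note dF = L_space_diff[OF pos(1) F[OF w] F[OF z]] and dG = L_space_diff[OF pos(2) G[OF w] G[OF z]]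
        note qF = Ldiv[OF dF, of "w - z"] and qG = Ldiv[OF dG, of "w - z"]
        note eF = L_space_diff[OF pos(1) qF D(1)] and eG = L_space_diff[OF pos(2) qG E(1)]
        have 1: "I (\<lambda>x. (F w x - F z x) / (w - z) - D x) (G w)
            = (I (F w) (G w) - I (F z) (G w)) / (w - z) - I D (G w)"
          by (simp add: Idl[OF qF D(1) G[OF w]] Icl Idl[OF F[OF w] F[OF z] G[OF w]])
        have 2: "I D (\<lambda>x. G w x - G z x) = I D (G w) - I D (G z)"
          by (rule Idr[OF D(1) G[OF w] G[OF z]])
        have 3: "I (F z) (\<lambda>x. (G w x - G z x) / (w - z) - E x)
            = (I (F z) (G w) - I (F z) (G z)) / (w - z) - I (F z) E"
          by (simp add: Idr[OF F[OF z] qG E(1)] Icr Idr[OF F[OF z] G[OF w] G[OF z]])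
        have "(H w - H z) / (w - z) - (I D (G z) + I (F z) E)
            = I (\<lambda>x. (F w x - F z x) / (w - z) - D x) (G w) + I D (\<lambda>x. G w x - G z x)
              + I (F z) (\<lambda>x. (G w x - G z x) / (w - z) - E x)"
          unfolding 1 2 3 H_def by (simp add: diff_divide_distrib)
        then have "norm ((H w - H z) / (w - z) - (I D (G z) + I (F z) E)) \<le> norm (I (\<lambda>x. (F w x - F z x) / (w - z) - D x) (G w)) + norm (I D (\<lambda>x. G w x - G z x))
              + norm (I (F z) (\<lambda>x. (G w x - G z x) / (w - z) - E x))"
          by (simp only:) (intro norm_triangle_mono order_refl)
        also have "\<dots> \<le> L_norm M r (\<lambda>x. (F w x - F z x) / (w - z) - D x) * L_norm M s (G w)
            + L_norm M r D * L_norm M s (\<lambda>x. G w x - G z x)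
            + L_norm M r (F z) * L_norm M s (\<lambda>x. (G w x - G z x) / (w - z) - E x)"
          by (rule add_mono[OF add_mono[OF Ile[OF eF G[OF w]] Ile[OF D(1) dG]] Ile[OF F[OF z] eG]])
        also have "\<dots> \<le> c w"
          unfolding c_def by (intro add_mono mult_left_mono Gb[OF w] L_norm_nonneg order_refl)
        finally show "norm ((H w - H z) / (w - z) - (I D (G z) + I (F z) E)) \<le> c w" .
      qed auto
    qed
    then show "\<exists>f'. (H has_field_derivative f') (at z within open_strip)"
      unfolding has_field_derivative_iff by (auto simp: LIM_zero_iff)
  qed
  have "norm (H z) \<le> B"
  proof (rule three_lines[OF hol cont Hb _ _ z])
    show "norm (H (Complex 0 t)) \<le> B" "norm (H (Complex 1 t)) \<le> B" for t
      using left right by (simp_all add: H_def I_def)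
  qed
  then show ?thesis by (simp add: H_def I_def)
qed

section \<open>The Calderon space of two Bergman spaces\<close>

lemma fcarrier_sum_space_bergman:
  assumes \<Omega>: "open \<Omega>" "bounded \<Omega>" and qp: "0 < q" "q \<le> p"
  shows "fcarrier (sum_space (bergman_space \<Omega> p) (bergman_space \<Omega> q)) = bergman \<Omega> q"
proof -
  have "f \<in> bergman \<Omega> q" if "f = (\<lambda>x. a x + b x)" "a \<in> bergman \<Omega> p" "b \<in> bergman \<Omega> q" for f a b
    using bergman_add[OF \<Omega>(1) qp(1) bergman_antimono[OF \<Omega> qp that(2)] that(3)] that(1) by simp
  moreover have "\<exists>a b. f = (\<lambda>x. a x + b x) \<and> a \<in> bergman \<Omega> p \<and> b \<in> bergman \<Omega> q"
    if f: "f \<in> bergman \<Omega> q" for f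
  proof -
    have "(\<lambda>x. 0) \<in> bergman \<Omega> p"
      by (rule zero_in_bergman[OF \<Omega>(1)])
    then show ?thesis using f by (intro exI[of _ "\<lambda>x. 0"] exI[of _ f]) auto
  qed
  ultimately show ?thesis by (auto simp: sum_space_def)
qed

text \<open>
  Because the smaller exponent gives the larger space, the sum norm is equivalent to the norm of that
  space. This turns continuity and analyticity in the sum norm into statements about \<open>L\<^sup>q\<close> norms.
\<close>

lemma sum_norm_bergman:
  fixes \<Omega> :: "(complex ^ 'n) set"
  assumes \<Omega>: "open \<Omega>" "bounded \<Omega>" and qp: "1 \<le> q" "q \<le> p"
  defines "X \<equiv> sum_space (bergman_space \<Omega> p) (bergman_space \<Omega> q)"
  shows sum_norm_nonneg: "f \<in> bergman \<Omega> q \<Longrightarrow> 0 \<le> fnorm X f"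
    and sum_norm_le: "f \<in> bergman \<Omega> q \<Longrightarrow> fnorm X f \<le> L_norm (lborel_on \<Omega>) q f"
    and L_norm_le_sum_norm: "\<exists>K>0. \<forall>f\<in>bergman \<Omega> q. L_norm (lborel_on \<Omega>) q f \<le> K * fnorm X f"
proof -
  let ?M = "lborel_on \<Omega>"
  define V where "V = (\<lambda>f. {L_norm ?M p a + L_norm ?M q b | a b.
    a \<in> bergman \<Omega> p \<and> b \<in> bergman \<Omega> q \<and> f = (\<lambda>x. a x + b x)})"
  have X: "fnorm X f = Inf (V f)" for f
    by (simp add: X_def sum_space_def V_def fnorm_bergman[OF \<Omega>(1)])
  have bdd: "bdd_below (V f)" and nonneg: "y \<in> V f \<Longrightarrow> 0 \<le> y" for f y
    by (auto simp: V_def intro!: bdd_belowI[of _ 0])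
  have mem: "L_norm ?M q f \<in> V f" if f: "f \<in> bergman \<Omega> q" for f
  proof -
    have "(\<lambda>x. 0) \<in> bergman \<Omega> p"
      by (rule zero_in_bergman[OF \<Omega>(1)])
    moreover have "L_norm ?M p (\<lambda>x. 0) = 0" by (simp add: L_norm_def)
    ultimately show ?thesis
      using f unfolding V_def by (intro CollectI exI[of _ "\<lambda>x. 0"] exI[of _ f]) simp
  qed
  show "0 \<le> fnorm X f" if "f \<in> bergman \<Omega> q"
    unfolding X using mem[OF that] nonneg by (intro cInf_greatest) auto
  show "fnorm X f \<le> L_norm ?M q f" if "f \<in> bergman \<Omega> q"
    unfolding X by (rule cInf_lower[OF mem[OF that] bdd])
  obtain K where K: "K > 0" "\<And>f. f \<in> L_space ?M p \<Longrightarrow> L_norm ?M q f \<le> K * L_norm ?M p f"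
    using L_norm_antimono[OF finite_measure_lborel_on[OF \<Omega>] _ qp(2)] qp(1) by auto
  show "\<exists>K>0. \<forall>f\<in>bergman \<Omega> q. L_norm ?M q f \<le> K * fnorm X f"
  proof (intro exI[of _ "2 * max K 1"] conjI ballI)
    fix f assume f: "f \<in> bergman \<Omega> q"
    have "L_norm ?M q f / (2 * max K 1) \<le> y" if y: "y \<in> V f" for y
    proof -
      obtain a b where ab: "a \<in> bergman \<Omega> p" "b \<in> bergman \<Omega> q" "f = (\<lambda>x. a x + b x)"
        "y = L_norm ?M p a + L_norm ?M q b"
        using y by (auto simp: V_def)
      have a: "a \<in> L_space ?M p" "a \<in> L_space ?M q" and b: "b \<in> L_space ?M q"
        using ab bergman_antimono[OF \<Omega> _ qp(2) ab(1)] qp \<Omega> by (auto simp: bergman_iff)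
      have "L_norm ?M q f \<le> 2 * (L_norm ?M q a + L_norm ?M q b)"
        unfolding ab(3) by (rule L_norm_add_le[OF qp(1) a(2) b])
      also have "\<dots> \<le> 2 * (max K 1 * L_norm ?M p a + max K 1 * L_norm ?M q b)"
        using order_trans[OF K(2)[OF a(1)] mult_right_mono[of K "max K 1"]]
          mult_right_mono[of 1 "max K 1" "L_norm ?M q b"]
        by (intro mult_left_mono add_mono) auto
      also have "\<dots> = 2 * max K 1 * y" by (simp add: ab(4) distrib_left)
      finally show ?thesis by (simp add: divide_le_eq mult.commute)
    qed
    then have "L_norm ?M q f / (2 * max K 1) \<le> fnorm X f"
      unfolding X using mem[OF f] by (intro cInf_greatest) auto
    then show "L_norm ?M q f \<le> 2 * max K 1 * fnorm X f"
      by (simp add: divide_le_eq mult.commute)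
  qed auto
qed

lemma calderon_boundary_le:
  assumes "F \<in> calderon_functions X0 X1"
  shows "fnorm X0 (F (Complex 0 t)) \<le> calderon_norm X0 X1 F"
    and "fnorm X1 (F (Complex 1 t)) \<le> calderon_norm X0 X1 F"
proof -
  have bdd: "bdd_above (range (\<lambda>t. fnorm X0 (F (Complex 0 t))))"
    "bdd_above (range (\<lambda>t. fnorm X1 (F (Complex 1 t))))"
    using assms by (simp_all add: calderon_functions_def)
  show "fnorm X0 (F (Complex 0 t)) \<le> calderon_norm X0 X1 F"
    unfolding calderon_norm_def by (rule max.coboundedI1[OF cSUP_upper[OF UNIV_I bdd(1)]])
  show "fnorm X1 (F (Complex 1 t)) \<le> calderon_norm X0 X1 F"
    unfolding calderon_norm_def by (rule max.coboundedI2[OF cSUP_upper[OF UNIV_I bdd(2)]])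
qed

lemma calderon_L_norm:
  fixes \<Omega> :: "(complex ^ 'n) set"
  assumes \<Omega>: "open \<Omega>" "bounded \<Omega>" and qp: "1 \<le> q" "q \<le> p"
    and F: "F \<in> calderon_functions (bergman_space \<Omega> p) (bergman_space \<Omega> q)"
  shows calderon_in_bergman: "\<And>z. z \<in> closed_strip \<Longrightarrow> F z \<in> bergman \<Omega> q"
    and calderon_L_norm_bounded: "\<exists>B. \<forall>z\<in>closed_strip. L_norm (lborel_on \<Omega>) q (F z) \<le> B"
    and calderon_L_norm_continuous: "\<And>z. z \<in> closed_strip \<Longrightarrow>
      ((\<lambda>w. L_norm (lborel_on \<Omega>) q (\<lambda>x. F w x - F z x)) \<longlongrightarrow> 0) (at z within closed_strip)"
    and calderon_L_norm_differentiable: "\<And>z. z \<in> open_strip \<Longrightarrow> \<exists>D\<in>L_space (lborel_on \<Omega>) q.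
      ((\<lambda>w. L_norm (lborel_on \<Omega>) q (\<lambda>x. (F w x - F z x) / (w - z) - D x)) \<longlongrightarrow> 0) (at z within open_strip)"
proof -
  let ?X = "sum_space (bergman_space \<Omega> p) (bergman_space \<Omega> q)"
  let ?N = "L_norm (lborel_on \<Omega>) q"
  have q: "0 < q" using qp by simp
  note carrier = fcarrier_sum_space_bergman[OF \<Omega> q qp(2)]
  have sub: "open_strip \<subseteq> closed_strip" by (auto simp: open_strip_def closed_strip_def)
  show FA: "F z \<in> bergman \<Omega> q" if "z \<in> closed_strip" for z
    using F that by (simp add: calderon_functions_def carrier)
  obtain K where K: "K > 0" "\<And>f. f \<in> bergman \<Omega> q \<Longrightarrow> ?N f \<le> K * fnorm ?X f"
    using L_norm_le_sum_norm[OF \<Omega> qp] by blast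
  have limK: "((\<lambda>w. ?N (d w)) \<longlongrightarrow> 0) (at z within S)"
    if lim: "((\<lambda>w. fnorm ?X (d w)) \<longlongrightarrow> 0) (at z within S)" and d: "\<And>w. w \<in> S \<Longrightarrow> d w \<in> bergman \<Omega> q"
    for d S and z :: complex
  proof (rule Lim_null_comparison)
    show "((\<lambda>w. K * fnorm ?X (d w)) \<longlongrightarrow> 0) (at z within S)"
      by (rule tendsto_mult_right_zero[OF lim])
    show "\<forall>\<^sub>F w in at z within S. norm (?N (d w)) \<le> K * fnorm ?X (d w)"
      unfolding eventually_at_topological using K(2)[OF d] by (intro exI[of _ UNIV]) auto
  qed
  obtain B where B: "\<And>z. z \<in> closed_strip \<Longrightarrow> fnorm ?X (F z) \<le> B"
    using F by (auto simp: calderon_functions_def)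
  have "?N (F z) \<le> K * B" if "z \<in> closed_strip" for z
    using order_trans[OF K(2)[OF FA[OF that]] mult_left_mono[OF B[OF that]]] K(1) by simp
  then show "\<exists>B. \<forall>z\<in>closed_strip. ?N (F z) \<le> B" by blast
  show "((\<lambda>w. ?N (\<lambda>x. F w x - F z x)) \<longlongrightarrow> 0) (at z within closed_strip)" if z: "z \<in> closed_strip" for z
  proof (rule limK)
    show "((\<lambda>w. fnorm ?X (\<lambda>x. F w x - F z x)) \<longlongrightarrow> 0) (at z within closed_strip)"
      using F z by (simp add: calderon_functions_def norm_continuous_on_def)
  qed (rule bergman_diff[OF \<Omega>(1) q FA FA[OF z]])
  show "\<exists>D\<in>L_space (lborel_on \<Omega>) q.
      ((\<lambda>w. ?N (\<lambda>x. (F w x - F z x) / (w - z) - D x)) \<longlongrightarrow> 0) (at z within open_strip)"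
    if z: "z \<in> open_strip" for z
  proof -
    have zc: "z \<in> closed_strip" using z sub by auto
    obtain D where D: "D \<in> bergman \<Omega> q"
      "((\<lambda>w. fnorm ?X (\<lambda>x. (F w x - F z x) / (w - z) - D x)) \<longlongrightarrow> 0) (at z within open_strip)"
      using F z unfolding calderon_functions_def norm_analytic_on_def carrier by blast
    have "((\<lambda>w. ?N (\<lambda>x. (F w x - F z x) / (w - z) - D x)) \<longlongrightarrow> 0) (at z within open_strip)"
    proof (rule limK[OF D(2)])
      fix w assume "w \<in> open_strip"
      then have "w \<in> closed_strip" using sub by auto
      from bergman_cmult[OF \<Omega>(1) bergman_diff[OF \<Omega>(1) q FA[OF this] FA[OF zc]], of "1 / (w - z)"]
      have "(\<lambda>x. (F w x - F z x) / (w - z)) \<in> bergman \<Omega> q" by simp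
      from bergman_diff[OF \<Omega>(1) q this D(1)]
      show "(\<lambda>x. (F w x - F z x) / (w - z) - D x) \<in> bergman \<Omega> q" .
    qed
    then show ?thesis using D(1) \<Omega>(1) by (auto simp: bergman_iff)
  qed
qed

section \<open>Both inclusions\<close>

lemma interpolation_exponents:
  fixes p q \<theta> t :: real
  assumes "1 < q" "q < p" "1 / p + 1 / q = 1" "0 < \<theta>" "\<theta> < 1" "1 / t = (1 - \<theta>) / p + \<theta> / q"
  shows "0 < t" "q \<le> t" "(1 - \<theta>) / q + \<theta> / p = 1 - 1 / t"
proof -
  have "0 < 1 / t" unfolding assms(6) using assms by (intro add_pos_pos divide_pos_pos) auto
  then show t: "0 < t" by simp
  have "1 / t \<le> (1 - \<theta>) / q + \<theta> / q"
    unfolding assms(6) using assms by (intro add_mono divide_left_mono) auto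
  also have "\<dots> = 1 / q" by (simp add: add_divide_distrib[symmetric])
  finally show "q \<le> t" using t assms(1) by (simp add: field_simps)
  have "1 / q = 1 - 1 / p" using assms(3) by simp
  then have "(1 - \<theta>) * (1 / q) + \<theta> * (1 / p) + ((1 - \<theta>) * (1 / p) + \<theta> * (1 / q)) = 1"
    by (simp only:) (simp add: algebra_simps)
  then show "(1 - \<theta>) / q + \<theta> / p = 1 - 1 / t" unfolding assms(6) by simp
qed

text \<open>
  Let \<open>v\<close> be \<open>\<bar>f\<bar> ^ t\<close>, cut off where \<open>\<bar>f\<bar> > n\<close>, with integral \<open>S\<close>, and put \<open>u = v / S\<close>. The dual family
  \<open>G z = cnj (sgn f) \<cdot> u ^ ((1 - z) / q + z / p)\<close> has norm at most 1 in \<open>L\<^sup>q\<close> on the left line and in \<open>L\<^sup>p\<close> on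
  the right line, opposite to the exponents of \<open>F\<close>, so \<open>\<integral> F z \<cdot> G z\<close> is at most \<open>c\<close> on both lines. At \<open>\<theta>\<close>
  the exponent is \<open>1 - 1 / t\<close> and the integral equals \<open>S ^ (1 / t)\<close>. Thus \<open>S \<le> c ^ t\<close> for every \<open>n\<close>.
\<close>

lemma interpolated_in_L_space:
  fixes \<Omega> :: "(complex ^ 'n) set"
  assumes \<Omega>: "open \<Omega>" "bounded \<Omega>" and pq: "1 < q" "q < p" "1 / p + 1 / q = 1"
    and \<theta>: "0 < \<theta>" "\<theta> < 1" and t: "1 / t = (1 - \<theta>) / p + \<theta> / q"
    and F: "F \<in> calderon_functions (bergman_space \<Omega> p) (bergman_space \<Omega> q)"
  defines "c \<equiv> calderon_norm (bergman_space \<Omega> p) (bergman_space \<Omega> q) F"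
  shows "F (complex_of_real \<theta>) \<in> L_space (lborel_on \<Omega>) t"
    and "L_norm (lborel_on \<Omega>) t (F (complex_of_real \<theta>)) \<le> c"
proof -
  let ?M = "lborel_on \<Omega>"
  interpret finite_measure ?M by (rule finite_measure_lborel_on[OF \<Omega>])
  note exps = interpolation_exponents[OF pq \<theta> t]
  have q1: "1 \<le> q" "q \<le> p" "1 < p" "0 < p" "0 < q" "1 / q + 1 / p = 1" using pq by auto
  note FA = calderon_in_bergman[OF \<Omega> q1(1,2) F]
  have FL: "F z \<in> L_space ?M q" if "z \<in> closed_strip" for z
    using FA[OF that] \<Omega> by (simp add: bergman_iff)
  have left: "F (Complex 0 s) \<in> L_space ?M p" "L_norm ?M p (F (Complex 0 s)) \<le> c"
    and right: "F (Complex 1 s) \<in> L_space ?M q" "L_norm ?M q (F (Complex 1 s)) \<le> c" for s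
    using F calderon_boundary_le[OF F, of s] \<Omega>
    by (auto simp: calderon_functions_def bergman_iff c_def fnorm_bergman)
  have c0: "0 \<le> c" using order_trans[OF L_norm_nonneg left(2)] .
  have \<theta>s: "complex_of_real \<theta> \<in> closed_strip" using \<theta> by (simp add: closed_strip_def)
  define f where "f = F (complex_of_real \<theta>)"
  have fm[measurable]: "f \<in> borel_measurable ?M"
    unfolding f_def using FL[OF \<theta>s] by (rule L_space_measurable)
  define v where "v = (\<lambda>n x. if norm (f x) \<le> real n then norm (f x) powr t else 0)"
  have v: "0 \<le> v n x" "v n x \<le> real n powr t" for n x
    using exps(1) by (auto simp: v_def intro: powr_mono2)
  have [measurable]: "v n \<in> borel_measurable ?M" for n
    unfolding v_def by measurable
  have vi: "integrable ?M (v n)" for n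
    by (rule integrable_const_bound[where B = "real n powr t"]) (use v in auto)
  have main: "(\<integral>x. v n x \<partial>?M) \<le> c powr t" for n
  proof (cases "(\<integral>x. v n x \<partial>?M) = 0")
    case False
    define S where "S = (\<integral>x. v n x \<partial>?M)"
    have S: "0 < S"
      using False integral_nonneg_AE[of "v n" ?M] v(1) by (auto simp: S_def less_le)
    \<comment> \<open>The cut-off makes \<open>u\<close> bounded, so that all its positive powers are integrable on the finite measure space.\<close>
    define u where "u = (\<lambda>x. v n x / S)"
    define \<sigma> where "\<sigma> = (\<lambda>x. cnj (f x) / of_real (norm (f x)))"
    have u: "0 \<le> u x" "u x \<le> real n powr t / S" for x
      using v S by (auto simp: u_def divide_right_mono)
    have um[measurable]: "u \<in> borel_measurable ?M" unfolding u_def by measurable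
    have [measurable]: "(\<lambda>x. cnj (f x)) \<in> borel_measurable ?M"
      using L_space_cnj[OF FL[OF \<theta>s]] unfolding f_def by (rule L_space_measurable)
    have \<sigma>m[measurable]: "\<sigma> \<in> borel_measurable ?M" unfolding \<sigma>_def by measurable
    have \<sigma>1: "norm (\<sigma> x) \<le> 1" for x by (simp add: \<sigma>_def norm_divide)
    have ui: "integrable ?M u" unfolding u_def using vi by simp
    have u1: "(\<integral>x. u x \<partial>?M) \<le> 1"
      unfolding u_def using S by (simp add: S_def)
    have upow: "integrable ?M (\<lambda>x. u x powr e)" if "0 < e" for e
      by (rule integrable_const_bound[where B = "(real n powr t / S) powr e"])
         (use u that in \<open>auto intro!: AE_I2 powr_mono2\<close>)
    define G where "G = power_family \<sigma> u (1 / q) (1 / p)"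
    note G = power_family_L_space[OF q1(4) \<sigma>m um \<sigma>1 u(1) upow upow, of "1 / q" "1 / p", folded G_def]
    have conj: "0 < 1 / q * p" "0 < 1 / p * p" using q1 by auto
    obtain Bf where Bf: "\<And>z. z \<in> closed_strip \<Longrightarrow> L_norm ?M q (F z) \<le> Bf"
      using calderon_L_norm_bounded[OF \<Omega> q1(1,2) F] by blast
    obtain Bg where Bg: "\<And>z. z \<in> closed_strip \<Longrightarrow> L_norm ?M p (G z) \<le> Bg"
      using G(2)[OF conj] by blast
    have Gleft: "G (Complex 0 s) \<in> L_space ?M q" "L_norm ?M q (G (Complex 0 s)) \<le> 1" for s
      unfolding G_def using q1 by (intro power_family_boundary_L_norm \<sigma>m um \<sigma>1 u ui u1; simp)+
    have Gright: "G (Complex 1 s) \<in> L_space ?M p" "L_norm ?M p (G (Complex 1 s)) \<le> 1" for s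
      unfolding G_def using q1 by (intro power_family_boundary_L_norm \<sigma>m um \<sigma>1 u ui u1; simp)+
    have "norm (\<integral>x. F (complex_of_real \<theta>) x * G (complex_of_real \<theta>) x \<partial>?M) \<le> c"
    proof (rule three_lines_pairing[OF pq(1) q1(3,6) FL Bf calderon_L_norm_continuous[OF \<Omega> q1(1,2) F]
          calderon_L_norm_differentiable[OF \<Omega> q1(1,2) F] G(1)[OF conj] Bg G(3)[OF conj] G(4)[OF conj] _ _ \<theta>s])
      fix s
      have "norm (\<integral>x. F (Complex 0 s) x * G (Complex 0 s) x \<partial>?M)
          \<le> L_norm ?M p (F (Complex 0 s)) * L_norm ?M q (G (Complex 0 s))"
        by (rule Holder_norm_le[OF q1(3) pq(1,3) left(1) Gleft(1)])
      also have "\<dots> \<le> c * 1"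
        by (intro mult_mono left Gleft c0 L_norm_nonneg)
      finally show "norm (\<integral>x. F (Complex 0 s) x * G (Complex 0 s) x \<partial>?M) \<le> c" by simp
      have "norm (\<integral>x. F (Complex 1 s) x * G (Complex 1 s) x \<partial>?M)
          \<le> L_norm ?M q (F (Complex 1 s)) * L_norm ?M p (G (Complex 1 s))"
        by (rule Holder_norm_le[OF pq(1) q1(3,6) right(1) Gright(1)])
      also have "\<dots> \<le> c * 1"
        by (intro mult_mono right Gright c0 L_norm_nonneg)
      finally show "norm (\<integral>x. F (Complex 1 s) x * G (Complex 1 s) x \<partial>?M) \<le> c" by simp
    qed
    moreover have "F (complex_of_real \<theta>) x * G (complex_of_real \<theta>) x = of_real (S powr (1 / t - 1) * v n x)" for x
    proof (cases "v n x = 0")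
      case True
      then show ?thesis by (simp add: G_def power_family_def u_def)
    next
      case False
      then have fx: "norm (f x) \<le> real n" "0 < norm (f x)" "v n x = norm (f x) powr t"
        by (auto simp: v_def split: if_splits)
      have ux: "0 < u x" using fx S by (simp add: u_def)
      have "((1 - complex_of_real \<theta>) * of_real (1 / q) + complex_of_real \<theta> * of_real (1 / p)) * of_real (ln (u x))
          = of_real (((1 - \<theta>) / q + \<theta> / p) * ln (u x))"
        by simp
      then have "G (complex_of_real \<theta>) x = \<sigma> x * exp (complex_of_real ((1 - 1 / t) * ln (u x)))"
        using ux unfolding G_def power_family_def exps(3) by (simp only: less_irrefl if_False) simp
      then have "G (complex_of_real \<theta>) x = \<sigma> x * of_real (u x powr (1 - 1 / t))"
        using ux by (simp add: powr_def exp_of_real del: of_real_mult of_real_diff)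
      moreover have "F (complex_of_real \<theta>) x * \<sigma> x = of_real (norm (f x))"
        using fx(2) complex_norm_square[of "f x"]
        by (simp add: \<sigma>_def f_def[symmetric] power2_eq_square divide_eq_eq)
      moreover have "norm (f x) * u x powr (1 - 1 / t) = S powr (1 / t - 1) * v n x"
      proof -
        have t1: "t * (1 - 1 / t) = t - 1" using exps(1) by (simp add: right_diff_distrib)
        have "u x powr (1 - 1 / t) = norm (f x) powr (t - 1) / S powr (1 - 1 / t)"
          using S by (simp only: u_def fx(3) powr_divide powr_powr t1)
        also have "\<dots> = norm (f x) powr (t - 1) * S powr (1 / t - 1)"
          using powr_minus_divide[of S "1 - 1 / t"] by simp
        finally show ?thesis using fx(2) by (simp add: fx(3) powr_diff)
      qed
      ultimately show ?thesis by (metis (no_types, lifting) mult.assoc of_real_mult)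
    qed
    ultimately have "norm (\<integral>x. complex_of_real (S powr (1 / t - 1) * v n x) \<partial>?M) \<le> c" by simp
    moreover have "(\<integral>x. complex_of_real (S powr (1 / t - 1) * v n x) \<partial>?M) = of_real (S powr (1 / t - 1) * S)"
      unfolding integral_complex_of_real by (simp add: S_def)
    moreover have "S powr (1 / t - 1) * S = S powr (1 / t)"
      using S by (simp add: powr_diff)
    ultimately have "S powr (1 / t) \<le> c" by simp
    then have "(S powr (1 / t)) powr t \<le> c powr t"
      using exps(1) by (intro powr_mono2) auto
    then show ?thesis using S exps(1) by (simp add: powr_powr flip: S_def)
  qed simp
  define E where "E = (\<lambda>n x. if norm (f x) \<le> real n then f x else 0)"
  have E: "norm (E n x) powr t = v n x" for n x by (simp add: E_def v_def)
  have Em: "E n \<in> borel_measurable ?M" for n unfolding E_def by measurable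
  have EL: "E n \<in> L_space ?M t" for n
    by (rule L_spaceI[OF Em]) (simp add: E vi)
  have En: "L_norm ?M t (E n) \<le> c" for n
    using exps(1) c0 main by (simp add: L_norm_le_iff E)
  have lim: "(\<lambda>n. E n x) \<longlonglongrightarrow> f x" for x
  proof (rule tendsto_eventually)
    obtain k where k: "norm (f x) \<le> real k" using real_arch_simple by blast
    show "\<forall>\<^sub>F n in sequentially. E n x = f x"
      using eventually_ge_at_top[of k] by eventually_elim (use k in \<open>simp add: E_def\<close>)
  qed
  show "F (complex_of_real \<theta>) \<in> L_space ?M t" "L_norm ?M t (F (complex_of_real \<theta>)) \<le> c"
    using L_norm_Fatou[OF exps(1) EL c0 En lim] by (simp_all add: f_def)
qed

text \<open>
  \<open>T\<close> is a common retraction of \<open>L\<^sup>p\<close> and \<open>L\<^sup>q\<close> onto the Bergman spaces. It carries the analytic family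
  through \<open>f\<close>, which lies in \<open>L\<^sup>p\<close> on the left line and in \<open>L\<^sup>q\<close> on the right line, to holomorphic
  functions. A bound \<open>c > 0\<close> instead of the norm of \<open>f\<close> itself avoids dividing by 0 for \<open>f = 0\<close>.
\<close>

lemma bergman_extends_to_calderon:
  fixes \<Omega> :: "(complex ^ 'n) set"
  assumes \<Omega>: "open \<Omega>" "bounded \<Omega>" and pq: "1 < q" "q < p" "1 / p + 1 / q = 1"
    and \<theta>: "0 < \<theta>" "\<theta> < 1" and t: "1 / t = (1 - \<theta>) / p + \<theta> / q"
    and Tp: "\<And>h. h \<in> L_space (lborel_on \<Omega>) p \<Longrightarrow> T h \<in> bergman \<Omega> p"
      "\<And>h. h \<in> L_space (lborel_on \<Omega>) p \<Longrightarrow> L_norm (lborel_on \<Omega>) p (T h) \<le> Cp * L_norm (lborel_on \<Omega>) p h"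
    and Tq: "\<And>h. h \<in> L_space (lborel_on \<Omega>) q \<Longrightarrow> T h \<in> bergman \<Omega> q"
      "\<And>h. h \<in> L_space (lborel_on \<Omega>) q \<Longrightarrow> L_norm (lborel_on \<Omega>) q (T h) \<le> Cq * L_norm (lborel_on \<Omega>) q h"
    and C: "0 < Cp" "0 < Cq"
    and T_diff: "\<And>h k. h \<in> L_space (lborel_on \<Omega>) q \<Longrightarrow> k \<in> L_space (lborel_on \<Omega>) q \<Longrightarrow>
      T (\<lambda>x. h x - k x) = (\<lambda>x. T h x - T k x)"
    and T_cmult: "\<And>a h. T (\<lambda>x. a * h x) = (\<lambda>x. a * T h x)"
    and T_id: "\<And>f. f \<in> bergman \<Omega> q \<Longrightarrow> T f = f"
    and f: "f \<in> bergman \<Omega> t" and c: "0 < c" "L_norm (lborel_on \<Omega>) t f \<le> c"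
  shows "\<exists>F\<in>calderon_functions (bergman_space \<Omega> p) (bergman_space \<Omega> q).
    F (complex_of_real \<theta>) = f \<and>
    calderon_norm (bergman_space \<Omega> p) (bergman_space \<Omega> q) F \<le> max Cp Cq * c"
proof -
  let ?M = "lborel_on \<Omega>"
  let ?N = "L_norm ?M q"
  let ?X = "sum_space (bergman_space \<Omega> p) (bergman_space \<Omega> q)"
  interpret finite_measure ?M by (rule finite_measure_lborel_on[OF \<Omega>])
  note exps = interpolation_exponents[OF pq \<theta> t]
  have q1: "1 \<le> q" "q \<le> p" "0 < p" "0 < q" using pq by auto
  have fL: "f \<in> L_space ?M t" using f \<Omega> by (simp add: bergman_iff)
  have fm[measurable]: "f \<in> borel_measurable ?M" by (rule L_space_measurable[OF fL])
  define \<sigma> where "\<sigma> = (\<lambda>x. f x / of_real (norm (f x)))"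
  define u where "u = (\<lambda>x. norm (f x) powr t / c powr t)"
  have \<sigma>m[measurable]: "\<sigma> \<in> borel_measurable ?M" and um[measurable]: "u \<in> borel_measurable ?M"
    unfolding \<sigma>_def u_def by measurable
  have \<sigma>1: "norm (\<sigma> x) \<le> 1" and u: "0 \<le> u x" for x
    by (simp_all add: \<sigma>_def u_def norm_divide)
  have ui: "integrable ?M u" unfolding u_def using L_space_integrable[OF fL] by simp
  have "(\<integral>x. norm (f x) powr t \<partial>?M) \<le> c powr t"
    using c exps(1) by (simp add: L_norm_le_iff)
  then have u1: "(\<integral>x. u x \<partial>?M) \<le> 1"
    unfolding u_def using c(1) by (simp add: divide_le_eq)
  have int: "integrable ?M (\<lambda>x. u x powr (1 / p * q))" "integrable ?M (\<lambda>x. u x powr (1 / q * q))"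
  proof -
    have le: "a powr (1 / p * q) \<le> 1 + a" if "0 \<le> a" for a :: real
    proof (cases "a \<le> 1")
      case True
      then show ?thesis using powr_mono2[of "1 / p * q" a 1] that q1 by (auto intro: add_increasing2)
    next
      case False
      then have "a powr (1 / p * q) \<le> a powr 1" using q1 by (intro powr_mono) auto
      then show ?thesis using False by simp
    qed
    show "integrable ?M (\<lambda>x. u x powr (1 / p * q))"
      by (rule Bochner_Integration.integrable_bound[where f = "\<lambda>x. 1 + u x"])
         (use ui u le in \<open>auto intro!: AE_I2 intro: order_trans[OF _ abs_ge_self]\<close>)
    show "integrable ?M (\<lambda>x. u x powr (1 / q * q))"
      using ui u q1 by simp
  qed
  define G where "G = power_family \<sigma> u (1 / p) (1 / q)"
  note G = power_family_L_space[OF q1(4) \<sigma>m um \<sigma>1 u int, folded G_def]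
  have Gleft: "G (Complex 0 s) \<in> L_space ?M p" "L_norm ?M p (G (Complex 0 s)) \<le> 1" for s
    unfolding G_def using q1 by (intro power_family_boundary_L_norm \<sigma>m um \<sigma>1 u ui u1; simp)+
  have Gright: "G (Complex 1 s) \<in> L_space ?M q" "?N (G (Complex 1 s)) \<le> 1" for s
    unfolding G_def using q1 by (intro power_family_boundary_L_norm \<sigma>m um \<sigma>1 u ui u1; simp)+
  define U where "U = (\<lambda>h. T (\<lambda>x. complex_of_real c * h x))"
  have U_diff: "U (\<lambda>x. h x - k x) = (\<lambda>x. U h x - U k x)" if "h \<in> L_space ?M q" "k \<in> L_space ?M q" for h k
    using T_diff[OF L_space_cmult[OF that(1), of c] L_space_cmult[OF that(2), of c]]
    by (simp add: U_def right_diff_distrib)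
  have U_div: "U (\<lambda>x. h x / a) = (\<lambda>x. U h x / a)" for h a
    using T_cmult[of "1 / a" "\<lambda>x. complex_of_real c * h x"] by (simp add: U_def)
  have Up: "U h \<in> bergman \<Omega> p" "L_norm ?M p (U h) \<le> Cp * c * L_norm ?M p h" if "h \<in> L_space ?M p" for h
    using Tp[OF L_space_cmult[OF that, of c]] c(1) q1 by (simp_all add: U_def L_norm_cmult)
  have Uq: "U h \<in> bergman \<Omega> q" "?N (U h) \<le> Cq * c * ?N h" if "h \<in> L_space ?M q" for h
    using Tq[OF L_space_cmult[OF that, of c]] c(1) q1 by (simp_all add: U_def L_norm_cmult)
  note carrier = fcarrier_sum_space_bergman[OF \<Omega> q1(4,2)]
  have UX: "0 \<le> fnorm ?X (U h)" "fnorm ?X (U h) \<le> Cq * c * ?N h" if "h \<in> L_space ?M q" for h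
    using sum_norm_nonneg[OF \<Omega> q1(1,2) Uq(1)[OF that]]
      order_trans[OF sum_norm_le[OF \<Omega> q1(1,2) Uq(1)[OF that]] Uq(2)[OF that]] by auto
  have limU: "((\<lambda>w. fnorm ?X (U (d w))) \<longlongrightarrow> 0) (at z within S)"
    if lim: "((\<lambda>w. ?N (d w)) \<longlongrightarrow> 0) (at z within S)" and d: "\<And>w. w \<in> S \<Longrightarrow> d w \<in> L_space ?M q"
    for d S and z :: complex
  proof (rule Lim_null_comparison)
    show "((\<lambda>w. Cq * c * ?N (d w)) \<longlongrightarrow> 0) (at z within S)"
      by (rule tendsto_mult_right_zero[OF lim])
    show "\<forall>\<^sub>F w in at z within S. norm (fnorm ?X (U (d w))) \<le> Cq * c * ?N (d w)"
      unfolding eventually_at_topological using UX[OF d] by (intro exI[of _ UNIV]) auto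
  qed
  have sub: "open_strip \<subseteq> closed_strip" by (auto simp: open_strip_def closed_strip_def)
  define F where "F = (\<lambda>z. U (G z))"
  have left: "F (Complex 0 s) \<in> bergman \<Omega> p" "L_norm ?M p (F (Complex 0 s)) \<le> max Cp Cq * c" for s
  proof -
    show "F (Complex 0 s) \<in> bergman \<Omega> p" unfolding F_def by (rule Up(1)[OF Gleft(1)])
    have "L_norm ?M p (F (Complex 0 s)) \<le> Cp * c * L_norm ?M p (G (Complex 0 s))"
      unfolding F_def by (rule Up(2)[OF Gleft(1)])
    also have "\<dots> \<le> max Cp Cq * c * 1"
      using c(1) C Gleft(2) by (intro mult_mono) auto
    finally show "L_norm ?M p (F (Complex 0 s)) \<le> max Cp Cq * c" by simp
  qed
  have right: "F (Complex 1 s) \<in> bergman \<Omega> q" "?N (F (Complex 1 s)) \<le> max Cp Cq * c" for s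
  proof -
    show "F (Complex 1 s) \<in> bergman \<Omega> q" unfolding F_def by (rule Uq(1)[OF Gright(1)])
    have "?N (F (Complex 1 s)) \<le> Cq * c * ?N (G (Complex 1 s))"
      unfolding F_def by (rule Uq(2)[OF Gright(1)])
    also have "\<dots> \<le> max Cp Cq * c * 1"
      using c(1) C Gright(2) by (intro mult_mono) auto
    finally show "?N (F (Complex 1 s)) \<le> max Cp Cq * c" by simp
  qed
  have bdd: "bdd_above (range (\<lambda>s. fnorm (bergman_space \<Omega> p) (F (Complex 0 s))))"
    "bdd_above (range (\<lambda>s. fnorm (bergman_space \<Omega> q) (F (Complex 1 s))))"
    using left(2) right(2) by (auto simp: fnorm_bergman[OF \<Omega>(1)] intro!: bdd_aboveI2)
  have "F \<in> calderon_functions (bergman_space \<Omega> p) (bergman_space \<Omega> q)"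
    unfolding calderon_functions_def
  proof (intro CollectI conjI ballI allI bdd left(1) right(1))
    show "F z \<in> fcarrier ?X" if "z \<in> closed_strip" for z
      unfolding carrier F_def by (rule Uq(1)[OF G(1)[OF that]])
    obtain B where B: "\<And>z. z \<in> closed_strip \<Longrightarrow> ?N (G z) \<le> B" using G(2) by blast
    have "fnorm ?X (F z) \<le> Cq * c * B" if "z \<in> closed_strip" for z
      unfolding F_def using order_trans[OF UX(2)[OF G(1)[OF that]] mult_left_mono[OF B[OF that]]] C c by simp
    then show "\<exists>B. \<forall>z\<in>closed_strip. fnorm ?X (F z) \<le> B" by blast
    show "norm_continuous_on closed_strip ?X F"
      unfolding norm_continuous_on_def
    proof
      fix z assume z: "z \<in> closed_strip"
      have "((\<lambda>w. fnorm ?X (U (\<lambda>x. G w x - G z x))) \<longlongrightarrow> 0) (at z within closed_strip)"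
        by (rule limU[OF G(3)[OF z] L_space_diff[OF q1(4) G(1) G(1)[OF z]]])
      moreover have "\<forall>\<^sub>F w in at z within closed_strip.
          fnorm ?X (U (\<lambda>x. G w x - G z x)) = fnorm ?X (\<lambda>x. F w x - F z x)"
        unfolding eventually_at_topological F_def
        using U_diff[OF G(1) G(1)[OF z]] by (intro exI[of _ UNIV]) auto
      ultimately show "((\<lambda>w. fnorm ?X (\<lambda>x. F w x - F z x)) \<longlongrightarrow> 0) (at z within closed_strip)"
        by (rule Lim_transform_eventually)
    qed
    show "norm_analytic_on open_strip ?X F"
      unfolding norm_analytic_on_def
    proof
      fix z assume z: "z \<in> open_strip"
      then have zc: "z \<in> closed_strip" using sub by auto
      obtain D where D: "D \<in> L_space ?M q"
        "((\<lambda>w. ?N (\<lambda>x. (G w x - G z x) / (w - z) - D x)) \<longlongrightarrow> 0) (at z within open_strip)"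
        using G(4)[OF z] by blast
      have dL: "(\<lambda>x. G w x - G z x) \<in> L_space ?M q" if "w \<in> open_strip" for w
        using L_space_diff[OF q1(4) G(1) G(1)[OF zc]] that sub by auto
      have qL: "(\<lambda>x. (G w x - G z x) / (w - z)) \<in> L_space ?M q" if "w \<in> open_strip" for w
        using L_space_cmult[OF dL[OF that], of "1 / (w - z)"] by simp
      have "((\<lambda>w. fnorm ?X (U (\<lambda>x. (G w x - G z x) / (w - z) - D x))) \<longlongrightarrow> 0) (at z within open_strip)"
        by (rule limU[OF D(2) L_space_diff[OF q1(4) qL D(1)]])
      moreover have "\<forall>\<^sub>F w in at z within open_strip.
          fnorm ?X (U (\<lambda>x. (G w x - G z x) / (w - z) - D x)) = fnorm ?X (\<lambda>x. (F w x - F z x) / (w - z) - U D x)"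
        unfolding eventually_at_topological
      proof (intro exI[of _ UNIV] conjI ballI impI)
        fix w assume w: "w \<in> open_strip"
        then have wc: "w \<in> closed_strip" using sub by auto
        show "fnorm ?X (U (\<lambda>x. (G w x - G z x) / (w - z) - D x)) = fnorm ?X (\<lambda>x. (F w x - F z x) / (w - z) - U D x)"
          unfolding U_diff[OF qL[OF w] D(1)] U_div U_diff[OF G(1)[OF wc] G(1)[OF zc]] F_def ..
      qed auto
      ultimately have "((\<lambda>w. fnorm ?X (\<lambda>x. (F w x - F z x) / (w - z) - U D x)) \<longlongrightarrow> 0) (at z within open_strip)"
        by (rule Lim_transform_eventually)
      then show "\<exists>D\<in>fcarrier ?X. ((\<lambda>w. fnorm ?X (\<lambda>x. (F w x - F z x) / (w - z) - D x)) \<longlongrightarrow> 0) (at z within open_strip)"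
        unfolding carrier using Uq(1)[OF D(1)] by blast
    qed
  qed
  moreover have "F (complex_of_real \<theta>) = f"
  proof -
    have "complex_of_real c * G (complex_of_real \<theta>) x = f x" for x
    proof (cases "f x = 0")
      case False
      then have ux: "0 < u x" using c(1) by (simp add: u_def)
      have "((1 - complex_of_real \<theta>) * of_real (1 / p) + complex_of_real \<theta> * of_real (1 / q)) * of_real (ln (u x))
          = of_real (((1 - \<theta>) / p + \<theta> / q) * ln (u x))"
        by simp
      then have "G (complex_of_real \<theta>) x = \<sigma> x * exp (complex_of_real (1 / t * ln (u x)))"
        using ux unfolding G_def power_family_def t[symmetric] by (simp only: less_irrefl if_False) simp
      also have "\<dots> = \<sigma> x * of_real (u x powr (1 / t))"
        using ux by (simp add: powr_def exp_of_real del: of_real_mult of_real_divide)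
      also have "u x powr (1 / t) = norm (f x) / c"
        using c(1) exps(1) by (simp add: u_def powr_divide powr_powr)
      finally show ?thesis using False c(1) by (simp add: \<sigma>_def)
    qed (simp add: G_def power_family_def u_def)
    then have "F (complex_of_real \<theta>) = T f" by (simp add: F_def U_def)
    also have "\<dots> = f" by (rule T_id[OF bergman_antimono[OF \<Omega> q1(4) exps(2) f]])
    finally show ?thesis .
  qed
  moreover have "calderon_norm (bergman_space \<Omega> p) (bergman_space \<Omega> q) F \<le> max Cp Cq * c"
    unfolding calderon_norm_def using left(2) right(2)
    by (intro max.boundedI cSUP_least) (auto simp: fnorm_bergman[OF \<Omega>(1)])
  ultimately show ?thesis by blast
qed

theorem theorem2p3:
  fixes \<Omega> :: "(complex ^ 'n) set" and p q \<theta> p\<^sub>\<theta> :: real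
  assumes "bounded_domain \<Omega>"
    and "1 < q" and "q < 2" and "2 < p" and "1 / p + 1 / q = 1"
    and "Phi_surjective \<Omega> p q"
    and "Phi_surjective \<Omega> q p"
    and "0 < \<theta>" and "\<theta> < 1"
    and "1 / p\<^sub>\<theta> = (1 - \<theta>) / p + \<theta> / q"
  shows "equal_with_equivalent_norms
           (complex_interpolation (bergman_space \<Omega> p) (bergman_space \<Omega> q) \<theta>)
           (bergman_space \<Omega> p\<^sub>\<theta>)"
proof -
  let ?M = "lborel_on \<Omega>"
  let ?P = "bergman_space \<Omega> p" and ?Q = "bergman_space \<Omega> q"
  let ?I = "complex_interpolation ?P ?Q \<theta>"
  have \<Omega>: "open \<Omega>" "bounded \<Omega>" using assms(1) by (auto simp: bounded_domain_def)
  have pq: "1 < q" "q < p" "1 / p + 1 / q = 1" and q1: "0 < q" "1 \<le> q" "q \<le> p" "1 < p" "1 / q + 1 / p = 1"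
    using assms by auto
  note setting = \<Omega> pq assms(8,9,10)
  note exps = interpolation_exponents[OF pq assms(8,9,10)]
  have incl: "f \<in> bergman \<Omega> q" if "f \<in> bergman \<Omega> p" for f
    by (rule bergman_antimono[OF \<Omega> q1(1,3) that])
  have "\<exists>k\<in>bergman \<Omega> p. \<forall>f\<in>bergman \<Omega> q. f z = pairing \<Omega> f k" if z: "z \<in> \<Omega>" for z
  proof -
    obtain C where "\<And>f. f \<in> bergman \<Omega> q \<Longrightarrow> norm (f z) \<le> C * L_norm ?M q f"
      using bergman_point_evaluation[OF \<Omega> q1(2) z] by blast
    then show ?thesis by (intro Phi_surjectiveD[OF assms(7) \<Omega>(1) q1(1)]) auto
  qed
  then obtain \<kappa> where \<kappa>: "\<And>z. z \<in> \<Omega> \<Longrightarrow> \<kappa> z \<in> bergman \<Omega> p"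
    and repr: "\<And>z f. z \<in> \<Omega> \<Longrightarrow> f \<in> bergman \<Omega> q \<Longrightarrow> f z = pairing \<Omega> f (\<kappa> z)"
    by metis
  let ?T = "bergman_projection \<Omega> \<kappa>"
  note boundp = bergman_projection_bounded[OF \<Omega>(1) pq(1) q1(4,5) assms(7) incl[OF \<kappa>] repr[OF _ incl]]
  note boundq = bergman_projection_bounded[OF \<Omega>(1) q1(4) pq(1,3) assms(6) \<kappa> repr]
  obtain Cp where Cp: "0 < Cp" "\<And>h. h \<in> L_space ?M p \<Longrightarrow> L_norm ?M p (?T h) \<le> Cp * L_norm ?M p h"
    using boundp(2) by blast
  obtain Cq where Cq: "0 < Cq" "\<And>h. h \<in> L_space ?M q \<Longrightarrow> L_norm ?M q (?T h) \<le> Cq * L_norm ?M q h"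
    using boundq(2) by blast
  have T_id: "?T f = f" if "f \<in> bergman \<Omega> q" for f
    using repr[OF _ that] that \<Omega>(1) by (auto simp: bergman_projection_def bergman_iff)
  have Tp: "?T h \<in> bergman \<Omega> p" if "h \<in> L_space ?M p" for h
    by (rule boundp(1)) (use that in auto)
  have Tq: "?T h \<in> bergman \<Omega> q" if "h \<in> L_space ?M q" for h
    by (rule boundq(1)) (use that in auto)
  have T_diff: "?T (\<lambda>x. h x - k x) = (\<lambda>x. ?T h x - ?T k x)"
    if "h \<in> L_space ?M q" "k \<in> L_space ?M q" for h k
    by (rule bergman_projection_diff[OF \<Omega>(1) pq(1) q1(4,5) \<kappa> that])
  define V where "V = (\<lambda>f. {calderon_norm ?P ?Q F | F. F \<in> calderon_functions ?P ?Q \<and> F (complex_of_real \<theta>) = f})"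
  have I: "fnorm ?I f = Inf (V f)" for f
    by (simp add: complex_interpolation_def V_def)
  have bounded_below: "f \<in> bergman \<Omega> p\<^sub>\<theta> \<and> L_norm ?M p\<^sub>\<theta> f \<le> y" if y: "y \<in> V f" for f y
  proof -
    obtain F where F: "F \<in> calderon_functions ?P ?Q" "F (complex_of_real \<theta>) = f" "y = calderon_norm ?P ?Q F"
      using y by (auto simp: V_def)
    have "complex_of_real \<theta> \<in> closed_strip" using assms(8,9) by (simp add: closed_strip_def)
    from calderon_in_bergman[OF \<Omega> q1(2,3) F(1) this]
    show ?thesis
      using interpolated_in_L_space[OF setting F(1)] F(2,3) \<Omega>(1) by (simp add: bergman_iff)
  qed
  have attained: "\<exists>y\<in>V f. y \<le> max Cp Cq * c" if "f \<in> bergman \<Omega> p\<^sub>\<theta>" "0 < c" "L_norm ?M p\<^sub>\<theta> f \<le> c" for f c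
  proof -
    have "\<exists>F\<in>calderon_functions ?P ?Q. F (complex_of_real \<theta>) = f \<and> calderon_norm ?P ?Q F \<le> max Cp Cq * c"
      using bergman_projection_cmult[OF \<Omega>(1), of \<kappa>]
      by (intro bergman_extends_to_calderon[OF setting Tp Cp(2) Tq Cq(2) Cp(1) Cq(1) T_diff _ T_id that])
    then show ?thesis by (auto simp: V_def)
  qed
  have carrier: "f \<in> fcarrier ?I \<longleftrightarrow> V f \<noteq> {}" for f
    by (auto simp: complex_interpolation_def V_def)
  have eq: "fcarrier ?I = bergman \<Omega> p\<^sub>\<theta>"
  proof (intro set_eqI iffI)
    fix f assume "f \<in> bergman \<Omega> p\<^sub>\<theta>"
    then have "\<exists>y\<in>V f. y \<le> max Cp Cq * (L_norm ?M p\<^sub>\<theta> f + 1)"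
      by (intro attained add_nonneg_pos) auto
    then show "f \<in> fcarrier ?I" by (auto simp: carrier)
  next
    fix f assume "f \<in> fcarrier ?I"
    then show "f \<in> bergman \<Omega> p\<^sub>\<theta>" using bounded_below by (auto simp: carrier)
  qed
  have lower: "L_norm ?M p\<^sub>\<theta> f \<le> fnorm ?I f" if "f \<in> fcarrier ?I" for f
    unfolding I using that bounded_below by (intro cInf_greatest) (auto simp: carrier)
  have upper: "fnorm ?I f \<le> max Cp Cq * L_norm ?M p\<^sub>\<theta> f" if f: "f \<in> fcarrier ?I" for f
  proof (rule field_le_epsilon)
    fix e :: real assume e: "0 < e"
    define c where "c = L_norm ?M p\<^sub>\<theta> f + e / max Cp Cq"
    have "0 < e / max Cp Cq" using e Cp(1) by simp
    then have "0 < c" "L_norm ?M p\<^sub>\<theta> f \<le> c" by (auto simp: c_def add_nonneg_pos)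
    then obtain y where y: "y \<in> V f" "y \<le> max Cp Cq * c"
      using attained f eq by blast
    have "bdd_below (V f)"
      using bounded_below by (intro bdd_belowI[of _ "L_norm ?M p\<^sub>\<theta> f"]) auto
    then have "fnorm ?I f \<le> max Cp Cq * c"
      unfolding I using cInf_lower[OF y(1)] y(2) by auto
    also have "\<dots> = max Cp Cq * L_norm ?M p\<^sub>\<theta> f + e"
      using Cp(1) by (simp add: c_def distrib_left max_def)
    finally show "fnorm ?I f \<le> max Cp Cq * L_norm ?M p\<^sub>\<theta> f + e" .
  qed
  have C: "0 < max Cp Cq" using Cp(1) by simp
  show ?thesis
    unfolding equal_with_equivalent_norms_def fnorm_bergman[OF \<Omega>(1)]
    by (intro conjI eq exI[of _ 1] exI[of _ "max Cp Cq"] ballI C) (auto simp: lower upper)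
qed

end
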